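(* A double category of relations is locally preordered if and only if its accompanying factorisation system is right-proper.
   Context: A double category $\mathbb{D}$ is a pseudo double category: a category $\mathbb{D}_0=\mathbf{V}(\mathbb{D})$ of objects and vertical arrows, a category $\mathbb{D}_1$ of horizontal arrows $p\colon A\nrightarrow B$ and cells, with source, target, horizontal identities and horizontal composition associative and unital up to coherent isomorphism. Equivalence of double categories means equivalence in the 2-category of double categories, pseudo double functors and vertical transformations. A stable orthogonal factorisation system $(E,M)$ is an orthogonal factorisation system with $E$ stable under pullback; it is right-proper if every arrow in $M$ is a monomorphism. For a category $\mathbf{C}$ with finite limits and a stable orthogonal factorisation system $(E,M)$ on it, the double category $\mathbb{R}\mathrm{el}_{E,M}(\mathbf{C})$ has vertical category $\mathbf{C}$; horizontal arrows $A\nrightarrow B$ are arrows $\langle l,r\rangle\colon R\to A\times B$ in $M$; a cell from $R\to A\times B$ to $S\to C\times D$ with vertical sides $f\colon A\to C$, $g\colon B\to D$ is an arrow $R\to S$ commuting with $f\times g$ and the structure arrows; the composite of $R\colon A\nrightarrow B$ and $S\colon B\nrightarrow C$ is the $M$-part of the $(E,M)$-factorisation of $R\times_BS\to A\times C$; the identity on $A$ is the $M$-part of the factorisation of the diagonal $A\to A\times A$. A double category of relations is a double category $\mathbb{D}$ equivalent to some such $\mathbb{R}\mathrm{el}_{E,M}(\mathbf{C})$. Its accompanying factorisation system is the factorisation system on $\mathbf{V}(\mathbb{D})$ corresponding to $(E,M)$ under the induced equivalence $\mathbf{V}(\mathbb{D})\simeq\mathbf{C}$ (it is uniquely determined by $\mathbb{D}$).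 A double category is locally preordered if for any given pair of vertical arrows and pair of horizontal arrows forming a boundary there is at most one cell with that boundary. *)

theory Defs
  imports Main
begin

section \<open>Categories, functors, finite limits\<close>

text \<open>Composition is written in applicative order: \<open>g \<cdot> f\<close> is \<open>f\<close> followed by \<open>g\<close>. Nothing is
  required of the operations outside the carrier sets \<open>Obj C\<close> and \<open>Arr C\<close>.\<close>

record ('o, 'a) cat =
  Obj :: "'o set"
  Arr :: "'a set"
  Dom :: "'a \<Rightarrow> 'o"
  Cod :: "'a \<Rightarrow> 'o"
  Ident :: "'o \<Rightarrow> 'a"
  Cmp :: "'a \<Rightarrow> 'a \<Rightarrow> 'a"  (infixl "\<cdot>\<index>" 70)

definition in_hom :: "('o, 'a) cat \<Rightarrow> 'a \<Rightarrow> 'o \<Rightarrow> 'o \<Rightarrow> bool" where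
  "in_hom C f A B \<longleftrightarrow> f \<in> Arr C \<and> Dom C f = A \<and> Cod C f = B"

locale category =
  fixes C :: "('o, 'a) cat"
  assumes dom_obj: "f \<in> Arr C \<Longrightarrow> Dom C f \<in> Obj C"
    and cod_obj: "f \<in> Arr C \<Longrightarrow> Cod C f \<in> Obj C"
    and ident_hom: "A \<in> Obj C \<Longrightarrow> in_hom C (Ident C A) A A"
    and comp_hom: "\<lbrakk>in_hom C f X Y; in_hom C g Y Z\<rbrakk> \<Longrightarrow> in_hom C (g \<cdot>\<^bsub>C\<^esub> f) X Z"
    and ident_left: "in_hom C f X Y \<Longrightarrow> Ident C Y \<cdot>\<^bsub>C\<^esub> f = f"
    and ident_right: "in_hom C f X Y \<Longrightarrow> f \<cdot>\<^bsub>C\<^esub> Ident C X = f"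
    and comp_assoc: "\<lbrakk>in_hom C f W X; in_hom C g X Y; in_hom C h Y Z\<rbrakk>
      \<Longrightarrow> (h \<cdot>\<^bsub>C\<^esub> g) \<cdot>\<^bsub>C\<^esub> f = h \<cdot>\<^bsub>C\<^esub> (g \<cdot>\<^bsub>C\<^esub> f)"

definition iso_arr :: "('o, 'a) cat \<Rightarrow> 'a \<Rightarrow> bool" where
  "iso_arr C f \<longleftrightarrow> f \<in> Arr C \<and> (\<exists>g. in_hom C g (Cod C f) (Dom C f)
     \<and> g \<cdot>\<^bsub>C\<^esub> f = Ident C (Dom C f) \<and> f \<cdot>\<^bsub>C\<^esub> g = Ident C (Cod C f))"

definition mono_arr :: "('o, 'a) cat \<Rightarrow> 'a \<Rightarrow> bool" where
  "mono_arr C m \<longleftrightarrow> m \<in> Arr C \<and>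
     (\<forall>X u v. in_hom C u X (Dom C m) \<and> in_hom C v X (Dom C m) \<and> m \<cdot>\<^bsub>C\<^esub> u = m \<cdot>\<^bsub>C\<^esub> v
        \<longrightarrow> u = v)"

record ('o, 'a, 'p, 'b) ftor =
  omap :: "'o \<Rightarrow> 'p"
  amap :: "'a \<Rightarrow> 'b"

locale is_functor =
  fixes A :: "('o, 'a) cat" and B :: "('p, 'b) cat" and F :: "('o, 'a, 'p, 'b) ftor"
  assumes omap_obj: "X \<in> Obj A \<Longrightarrow> omap F X \<in> Obj B"
    and amap_hom: "in_hom A f X Y \<Longrightarrow> in_hom B (amap F f) (omap F X) (omap F Y)"
    and amap_ident: "X \<in> Obj A \<Longrightarrow> amap F (Ident A X) = Ident B (omap F X)"
    and amap_comp: "\<lbrakk>in_hom A f X Y; in_hom A g Y Z\<rbrakk>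
      \<Longrightarrow> amap F (g \<cdot>\<^bsub>A\<^esub> f) = amap F g \<cdot>\<^bsub>B\<^esub> amap F f"

definition ftor_id :: "('o, 'a, 'o, 'a) ftor" where
  "ftor_id = \<lparr>omap = (\<lambda>X. X), amap = (\<lambda>f. f)\<rparr>"

definition ftor_comp ::
  "('p, 'b, 'q, 'c) ftor \<Rightarrow> ('o, 'a, 'p, 'b) ftor \<Rightarrow> ('o, 'a, 'q, 'c) ftor" where
  "ftor_comp G F = \<lparr>omap = (\<lambda>X. omap G (omap F X)), amap = (\<lambda>f. amap G (amap F f))\<rparr>"

definition is_cone ::
  "('i, 'j) cat \<Rightarrow> ('o, 'a) cat \<Rightarrow> ('i, 'j, 'o, 'a) ftor \<Rightarrow> 'o \<Rightarrow> ('i \<Rightarrow> 'a) \<Rightarrow> bool" where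
  "is_cone J C F X t \<longleftrightarrow> X \<in> Obj C \<and> (\<forall>i\<in>Obj J. in_hom C (t i) X (omap F i))
     \<and> (\<forall>j\<in>Arr J. amap F j \<cdot>\<^bsub>C\<^esub> t (Dom J j) = t (Cod J j))"

definition is_limit ::
  "('i, 'j) cat \<Rightarrow> ('o, 'a) cat \<Rightarrow> ('i, 'j, 'o, 'a) ftor \<Rightarrow> 'o \<Rightarrow> ('i \<Rightarrow> 'a) \<Rightarrow> bool" where
  "is_limit J C F L t \<longleftrightarrow> is_cone J C F L t
     \<and> (\<forall>X s. is_cone J C F X s
          \<longrightarrow> (\<exists>!h. in_hom C h X L \<and> (\<forall>i\<in>Obj J. t i \<cdot>\<^bsub>C\<^esub> h = s i)))"

text \<open>Every finite category is isomorphic to one whose objects and arrows are natural numbers, so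
  quantifying over the latter covers all finite diagrams.\<close>

definition has_finite_limits :: "('o, 'a) cat \<Rightarrow> bool" where
  "has_finite_limits C \<longleftrightarrow> (\<forall>(J :: (nat, nat) cat) F.
     category J \<and> finite (Obj J) \<and> finite (Arr J) \<and> is_functor J C F
     \<longrightarrow> (\<exists>L t. is_limit J C F L t))"

definition is_product :: "('o, 'a) cat \<Rightarrow> 'o \<Rightarrow> 'o \<Rightarrow> 'a \<Rightarrow> 'a \<Rightarrow> bool" where
  "is_product C A B p q \<longleftrightarrow> in_hom C p (Dom C p) A \<and> in_hom C q (Dom C p) B
     \<and> (\<forall>X f g. in_hom C f X A \<and> in_hom C g X B
          \<longrightarrow> (\<exists>!h. in_hom C h X (Dom C p) \<and> p \<cdot>\<^bsub>C\<^esub> h = f \<and> q \<cdot>\<^bsub>C\<^esub> h = g))"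

definition is_pullback :: "('o, 'a) cat \<Rightarrow> 'a \<Rightarrow> 'a \<Rightarrow> 'a \<Rightarrow> 'a \<Rightarrow> bool" where
  "is_pullback C f g p q \<longleftrightarrow> f \<in> Arr C \<and> g \<in> Arr C \<and> Cod C f = Cod C g
     \<and> in_hom C p (Dom C p) (Dom C f) \<and> in_hom C q (Dom C p) (Dom C g)
     \<and> f \<cdot>\<^bsub>C\<^esub> p = g \<cdot>\<^bsub>C\<^esub> q
     \<and> (\<forall>X u v. in_hom C u X (Dom C f) \<and> in_hom C v X (Dom C g) \<and> f \<cdot>\<^bsub>C\<^esub> u = g \<cdot>\<^bsub>C\<^esub> v
          \<longrightarrow> (\<exists>!h. in_hom C h X (Dom C p) \<and> p \<cdot>\<^bsub>C\<^esub> h = u \<and> q \<cdot>\<^bsub>C\<^esub> h = v))"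


section \<open>Orthogonal factorisation systems\<close>

definition orthogonal :: "('o, 'a) cat \<Rightarrow> 'a \<Rightarrow> 'a \<Rightarrow> bool" where
  "orthogonal C e m \<longleftrightarrow> e \<in> Arr C \<and> m \<in> Arr C
     \<and> (\<forall>u v. in_hom C u (Dom C e) (Dom C m) \<and> in_hom C v (Cod C e) (Cod C m)
          \<and> m \<cdot>\<^bsub>C\<^esub> u = v \<cdot>\<^bsub>C\<^esub> e
          \<longrightarrow> (\<exists>!w. in_hom C w (Cod C e) (Dom C m) \<and> w \<cdot>\<^bsub>C\<^esub> e = u \<and> m \<cdot>\<^bsub>C\<^esub> w = v))"

definition is_factorisation :: "('o, 'a) cat \<Rightarrow> 'a set \<Rightarrow> 'a set \<Rightarrow> 'a \<Rightarrow> 'a \<Rightarrow> 'a \<Rightarrow> bool" where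
  "is_factorisation C E M f e m \<longleftrightarrow> e \<in> E \<and> m \<in> M
     \<and> in_hom C e (Dom C f) (Dom C m) \<and> in_hom C m (Dom C m) (Cod C f) \<and> m \<cdot>\<^bsub>C\<^esub> e = f"

locale orthogonal_factorisation_system =
  fixes C :: "('o, 'a) cat" and E M :: "'a set"
  assumes left_class: "E = {e \<in> Arr C. \<forall>m\<in>M. orthogonal C e m}"
    and right_class: "M = {m \<in> Arr C. \<forall>e\<in>E. orthogonal C e m}"
    and factorisation: "f \<in> Arr C \<Longrightarrow> \<exists>e m. is_factorisation C E M f e m"

locale stable_ofs = orthogonal_factorisation_system C E M
  for C :: "('o, 'a) cat" and E M :: "'a set" +
  assumes pullback_stable: "\<lbrakk>e \<in> E; is_pullback C f e p q\<rbrakk> \<Longrightarrow> p \<in> E"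

definition right_proper :: "('o, 'a) cat \<Rightarrow> 'a set \<Rightarrow> 'a set \<Rightarrow> bool" where
  "right_proper C E M \<longleftrightarrow> (\<forall>m\<in>M. mono_arr C m)"


section \<open>Pseudo double categories\<close>

text \<open>The objects of \<open>horz D\<close> are the horizontal arrows and its arrows are the cells. Horizontal
  composition is written in diagrammatic order: \<open>hc D p q\<close> composes \<open>p : A -> B\<close> with
  \<open>q : B -> C\<close>; it is a functor on the category of composable pairs.\<close>

record ('o, 'v, 'h, 'c) dblcat =
  vert :: "('o, 'v) cat"
  horz :: "('h, 'c) cat"
  src :: "('h, 'c, 'o, 'v) ftor"
  tgt :: "('h, 'c, 'o, 'v) ftor"
  hunit :: "('o, 'v, 'h, 'c) ftor"
  hcomp :: "('h \<times> 'h, 'c \<times> 'c, 'h, 'c) ftor"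
  assoc :: "'h \<Rightarrow> 'h \<Rightarrow> 'h \<Rightarrow> 'c"
  lunit :: "'h \<Rightarrow> 'c"
  runit :: "'h \<Rightarrow> 'c"

abbreviation hc :: "('o, 'v, 'h, 'c) dblcat \<Rightarrow> 'h \<Rightarrow> 'h \<Rightarrow> 'h" where
  "hc D p q \<equiv> omap (hcomp D) (p, q)"

abbreviation hcc :: "('o, 'v, 'h, 'c) dblcat \<Rightarrow> 'c \<Rightarrow> 'c \<Rightarrow> 'c" where
  "hcc D \<alpha> \<beta> \<equiv> amap (hcomp D) (\<alpha>, \<beta>)"

definition hor :: "('o, 'v, 'h, 'c) dblcat \<Rightarrow> 'h \<Rightarrow> 'o \<Rightarrow> 'o \<Rightarrow> bool" where
  "hor D p A B \<longleftrightarrow> p \<in> Obj (horz D) \<and> omap (src D) p = A \<and> omap (tgt D) p = B"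

definition composable_pairs :: "('o, 'v, 'h, 'c) dblcat \<Rightarrow> ('h \<times> 'h, 'c \<times> 'c) cat" where
  "composable_pairs D =
    \<lparr>Obj = {(p, q). p \<in> Obj (horz D) \<and> q \<in> Obj (horz D) \<and> omap (tgt D) p = omap (src D) q},
     Arr = {(\<alpha>, \<beta>). \<alpha> \<in> Arr (horz D) \<and> \<beta> \<in> Arr (horz D) \<and> amap (tgt D) \<alpha> = amap (src D) \<beta>},
     Dom = (\<lambda>(\<alpha>, \<beta>). (Dom (horz D) \<alpha>, Dom (horz D) \<beta>)),
     Cod = (\<lambda>(\<alpha>, \<beta>). (Cod (horz D) \<alpha>, Cod (horz D) \<beta>)),
     Ident = (\<lambda>(p, q). (Ident (horz D) p, Ident (horz D) q)),
     Cmp = (\<lambda>(\<alpha>', \<beta>') (\<alpha>, \<beta>). (\<alpha>' \<cdot>\<^bsub>horz D\<^esub> \<alpha>, \<beta>' \<cdot>\<^bsub>horz D\<^esub> \<beta>))\<rparr>"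

definition globular_iso :: "('o, 'v, 'h, 'c) dblcat \<Rightarrow> 'c \<Rightarrow> 'h \<Rightarrow> 'h \<Rightarrow> bool" where
  "globular_iso D \<gamma> p q \<longleftrightarrow> in_hom (horz D) \<gamma> p q \<and> iso_arr (horz D) \<gamma>
     \<and> amap (src D) \<gamma> = Ident (vert D) (omap (src D) p)
     \<and> amap (tgt D) \<gamma> = Ident (vert D) (omap (tgt D) p)"

locale double_category =
  fixes D :: "('o, 'v, 'h, 'c) dblcat"
  assumes vert_category: "category (vert D)"
    and horz_category: "category (horz D)"
    and src_functor: "is_functor (horz D) (vert D) (src D)"
    and tgt_functor: "is_functor (horz D) (vert D) (tgt D)"
    and hunit_functor: "is_functor (vert D) (horz D) (hunit D)"
    and hcomp_functor: "is_functor (composable_pairs D) (horz D) (hcomp D)"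
    and hunit_bdry_obj: "A \<in> Obj (vert D) \<Longrightarrow> hor D (omap (hunit D) A) A A"
    and hunit_bdry_arr: "f \<in> Arr (vert D)
      \<Longrightarrow> amap (src D) (amap (hunit D) f) = f \<and> amap (tgt D) (amap (hunit D) f) = f"
    and hcomp_bdry_obj: "\<lbrakk>hor D p A B; hor D q B C\<rbrakk> \<Longrightarrow> hor D (hc D p q) A C"
    and hcomp_bdry_arr: "(\<alpha>, \<beta>) \<in> Arr (composable_pairs D)
      \<Longrightarrow> amap (src D) (hcc D \<alpha> \<beta>) = amap (src D) \<alpha> \<and> amap (tgt D) (hcc D \<alpha> \<beta>) = amap (tgt D) \<beta>"
    and assoc_iso: "\<lbrakk>hor D p A B; hor D q B B'; hor D r B' C\<rbrakk>
      \<Longrightarrow> globular_iso D (assoc D p q r) (hc D (hc D p q) r) (hc D p (hc D q r))"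
    and assoc_natural:
      "\<lbrakk>in_hom (horz D) \<alpha> p p'; in_hom (horz D) \<beta> q q'; in_hom (horz D) \<gamma> r r';
        amap (tgt D) \<alpha> = amap (src D) \<beta>; amap (tgt D) \<beta> = amap (src D) \<gamma>\<rbrakk>
      \<Longrightarrow> assoc D p' q' r' \<cdot>\<^bsub>horz D\<^esub> hcc D (hcc D \<alpha> \<beta>) \<gamma>
        = hcc D \<alpha> (hcc D \<beta> \<gamma>) \<cdot>\<^bsub>horz D\<^esub> assoc D p q r"
    and lunit_iso: "hor D p A B
      \<Longrightarrow> globular_iso D (lunit D p) (hc D (omap (hunit D) A) p) p"
    and lunit_natural: "in_hom (horz D) \<alpha> p p'
      \<Longrightarrow> lunit D p' \<cdot>\<^bsub>horz D\<^esub> hcc D (amap (hunit D) (amap (src D) \<alpha>)) \<alpha>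
        = \<alpha> \<cdot>\<^bsub>horz D\<^esub> lunit D p"
    and runit_iso: "hor D p A B
      \<Longrightarrow> globular_iso D (runit D p) (hc D p (omap (hunit D) B)) p"
    and runit_natural: "in_hom (horz D) \<alpha> p p'
      \<Longrightarrow> runit D p' \<cdot>\<^bsub>horz D\<^esub> hcc D \<alpha> (amap (hunit D) (amap (tgt D) \<alpha>))
        = \<alpha> \<cdot>\<^bsub>horz D\<^esub> runit D p"
    and pentagon: "\<lbrakk>hor D p A\<^sub>0 A\<^sub>1; hor D q A\<^sub>1 A\<^sub>2; hor D r A\<^sub>2 A\<^sub>3; hor D s A\<^sub>3 A\<^sub>4\<rbrakk>
      \<Longrightarrow> assoc D p q (hc D r s) \<cdot>\<^bsub>horz D\<^esub> assoc D (hc D p q) r s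
        = hcc D (Ident (horz D) p) (assoc D q r s)
            \<cdot>\<^bsub>horz D\<^esub> assoc D p (hc D q r) s
            \<cdot>\<^bsub>horz D\<^esub> hcc D (assoc D p q r) (Ident (horz D) s)"
    and triangle: "\<lbrakk>hor D p A B; hor D q B C\<rbrakk>
      \<Longrightarrow> hcc D (Ident (horz D) p) (lunit D q) \<cdot>\<^bsub>horz D\<^esub> assoc D p (omap (hunit D) B) q
        = hcc D (runit D p) (Ident (horz D) q)"

definition locally_preordered :: "('o, 'v, 'h, 'c) dblcat \<Rightarrow> bool" where
  "locally_preordered D \<longleftrightarrow> (\<forall>\<alpha>\<in>Arr (horz D). \<forall>\<beta>\<in>Arr (horz D).
     Dom (horz D) \<alpha> = Dom (horz D) \<beta> \<and> Cod (horz D) \<alpha> = Cod (horz D) \<beta>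
     \<and> amap (src D) \<alpha> = amap (src D) \<beta> \<and> amap (tgt D) \<alpha> = amap (tgt D) \<beta>
     \<longrightarrow> \<alpha> = \<beta>)"


section \<open>Pseudo double functors, vertical transformations, equivalence\<close>

record ('o, 'v, 'h, 'c, 'p, 'w, 'k, 'd) pdf =
  pvert :: "('o, 'v, 'p, 'w) ftor"
  phorz :: "('h, 'c, 'k, 'd) ftor"
  pcomp :: "'h \<Rightarrow> 'h \<Rightarrow> 'd"
  punit :: "'o \<Rightarrow> 'd"

locale pseudo_double_functor =
  fixes D :: "('o, 'v, 'h, 'c) dblcat" and D' :: "('p, 'w, 'k, 'd) dblcat"
    and F :: "('o, 'v, 'h, 'c, 'p, 'w, 'k, 'd) pdf"
  assumes pvert_functor: "is_functor (vert D) (vert D') (pvert F)"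
    and phorz_functor: "is_functor (horz D) (horz D') (phorz F)"
    and phorz_bdry_obj: "hor D p A B
      \<Longrightarrow> hor D' (omap (phorz F) p) (omap (pvert F) A) (omap (pvert F) B)"
    and phorz_bdry_arr: "\<alpha> \<in> Arr (horz D)
      \<Longrightarrow> amap (src D') (amap (phorz F) \<alpha>) = amap (pvert F) (amap (src D) \<alpha>)
        \<and> amap (tgt D') (amap (phorz F) \<alpha>) = amap (pvert F) (amap (tgt D) \<alpha>)"
    and pcomp_iso: "\<lbrakk>hor D p A B; hor D q B C\<rbrakk>
      \<Longrightarrow> globular_iso D' (pcomp F p q)
            (hc D' (omap (phorz F) p) (omap (phorz F) q)) (omap (phorz F) (hc D p q))"
    and punit_iso: "A \<in> Obj (vert D)
      \<Longrightarrow> globular_iso D' (punit F A)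
            (omap (hunit D') (omap (pvert F) A)) (omap (phorz F) (omap (hunit D) A))"
    and pcomp_natural:
      "\<lbrakk>in_hom (horz D) \<alpha> p p'; in_hom (horz D) \<beta> q q'; amap (tgt D) \<alpha> = amap (src D) \<beta>\<rbrakk>
      \<Longrightarrow> amap (phorz F) (hcc D \<alpha> \<beta>) \<cdot>\<^bsub>horz D'\<^esub> pcomp F p q
        = pcomp F p' q' \<cdot>\<^bsub>horz D'\<^esub> hcc D' (amap (phorz F) \<alpha>) (amap (phorz F) \<beta>)"
    and punit_natural: "in_hom (vert D) f A B
      \<Longrightarrow> amap (phorz F) (amap (hunit D) f) \<cdot>\<^bsub>horz D'\<^esub> punit F A
        = punit F B \<cdot>\<^bsub>horz D'\<^esub> amap (hunit D') (amap (pvert F) f)"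
    and pcomp_assoc: "\<lbrakk>hor D p A B; hor D q B B'; hor D r B' C\<rbrakk>
      \<Longrightarrow> amap (phorz F) (assoc D p q r)
            \<cdot>\<^bsub>horz D'\<^esub> pcomp F (hc D p q) r
            \<cdot>\<^bsub>horz D'\<^esub> hcc D' (pcomp F p q) (Ident (horz D') (omap (phorz F) r))
        = pcomp F p (hc D q r)
            \<cdot>\<^bsub>horz D'\<^esub> hcc D' (Ident (horz D') (omap (phorz F) p)) (pcomp F q r)
            \<cdot>\<^bsub>horz D'\<^esub> assoc D' (omap (phorz F) p) (omap (phorz F) q) (omap (phorz F) r)"
    and pcomp_lunit: "hor D p A B
      \<Longrightarrow> amap (phorz F) (lunit D p)
            \<cdot>\<^bsub>horz D'\<^esub> pcomp F (omap (hunit D) A) p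
            \<cdot>\<^bsub>horz D'\<^esub> hcc D' (punit F A) (Ident (horz D') (omap (phorz F) p))
        = lunit D' (omap (phorz F) p)"
    and pcomp_runit: "hor D p A B
      \<Longrightarrow> amap (phorz F) (runit D p)
            \<cdot>\<^bsub>horz D'\<^esub> pcomp F p (omap (hunit D) B)
            \<cdot>\<^bsub>horz D'\<^esub> hcc D' (Ident (horz D') (omap (phorz F) p)) (punit F B)
        = runit D' (omap (phorz F) p)"

definition pdf_id :: "('o, 'v, 'h, 'c) dblcat \<Rightarrow> ('o, 'v, 'h, 'c, 'o, 'v, 'h, 'c) pdf" where
  "pdf_id D = \<lparr>pvert = ftor_id, phorz = ftor_id,
     pcomp = (\<lambda>p q. Ident (horz D) (hc D p q)),
     punit = (\<lambda>A. Ident (horz D) (omap (hunit D) A))\<rparr>"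

text \<open>The first argument is the codomain of \<open>G\<close>, where the comparison cells are composed.\<close>

definition pdf_comp ::
  "('q, 'x, 'l, 'e) dblcat \<Rightarrow> ('p, 'w, 'k, 'd, 'q, 'x, 'l, 'e) pdf
     \<Rightarrow> ('o, 'v, 'h, 'c, 'p, 'w, 'k, 'd) pdf \<Rightarrow> ('o, 'v, 'h, 'c, 'q, 'x, 'l, 'e) pdf" where
  "pdf_comp D'' G F = \<lparr>pvert = ftor_comp (pvert G) (pvert F),
     phorz = ftor_comp (phorz G) (phorz F),
     pcomp = (\<lambda>p q. amap (phorz G) (pcomp F p q)
       \<cdot>\<^bsub>horz D''\<^esub> pcomp G (omap (phorz F) p) (omap (phorz F) q)),
     punit = (\<lambda>A. amap (phorz G) (punit F A) \<cdot>\<^bsub>horz D''\<^esub> punit G (omap (pvert F) A))\<rparr>"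

record ('o, 'h, 'w, 'd) vtrans =
  tvert :: "'o \<Rightarrow> 'w"
  tcell :: "'h \<Rightarrow> 'd"

locale vertical_transformation =
  fixes D :: "('o, 'v, 'h, 'c) dblcat" and D' :: "('p, 'w, 'k, 'd) dblcat"
    and F G :: "('o, 'v, 'h, 'c, 'p, 'w, 'k, 'd) pdf"
    and \<eta> :: "('o, 'h, 'w, 'd) vtrans"
  assumes tvert_hom: "A \<in> Obj (vert D)
      \<Longrightarrow> in_hom (vert D') (tvert \<eta> A) (omap (pvert F) A) (omap (pvert G) A)"
    and tcell_hom: "p \<in> Obj (horz D)
      \<Longrightarrow> in_hom (horz D') (tcell \<eta> p) (omap (phorz F) p) (omap (phorz G) p)"
    and tcell_bdry: "hor D p A B
      \<Longrightarrow> amap (src D') (tcell \<eta> p) = tvert \<eta> A \<and> amap (tgt D') (tcell \<eta> p) = tvert \<eta> B"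
    and tvert_natural: "in_hom (vert D) f A B
      \<Longrightarrow> amap (pvert G) f \<cdot>\<^bsub>vert D'\<^esub> tvert \<eta> A = tvert \<eta> B \<cdot>\<^bsub>vert D'\<^esub> amap (pvert F) f"
    and tcell_natural: "in_hom (horz D) \<alpha> p q
      \<Longrightarrow> amap (phorz G) \<alpha> \<cdot>\<^bsub>horz D'\<^esub> tcell \<eta> p = tcell \<eta> q \<cdot>\<^bsub>horz D'\<^esub> amap (phorz F) \<alpha>"
    and tcell_comp: "\<lbrakk>hor D p A B; hor D q B C\<rbrakk>
      \<Longrightarrow> tcell \<eta> (hc D p q) \<cdot>\<^bsub>horz D'\<^esub> pcomp F p q
        = pcomp G p q \<cdot>\<^bsub>horz D'\<^esub> hcc D' (tcell \<eta> p) (tcell \<eta> q)"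
    and tcell_unit: "A \<in> Obj (vert D)
      \<Longrightarrow> tcell \<eta> (omap (hunit D) A) \<cdot>\<^bsub>horz D'\<^esub> punit F A
        = punit G A \<cdot>\<^bsub>horz D'\<^esub> amap (hunit D') (tvert \<eta> A)"

definition mutually_inverse ::
  "('o, 'v, 'h, 'c) dblcat \<Rightarrow> ('p, 'w, 'k, 'd) dblcat
     \<Rightarrow> ('o, 'v, 'h, 'c, 'p, 'w, 'k, 'd) pdf \<Rightarrow> ('o, 'v, 'h, 'c, 'p, 'w, 'k, 'd) pdf
     \<Rightarrow> ('o, 'h, 'w, 'd) vtrans \<Rightarrow> ('o, 'h, 'w, 'd) vtrans \<Rightarrow> bool" where
  "mutually_inverse D D' F G \<eta> \<theta> \<longleftrightarrow>
     (\<forall>A\<in>Obj (vert D). tvert \<theta> A \<cdot>\<^bsub>vert D'\<^esub> tvert \<eta> A = Ident (vert D') (omap (pvert F) A)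
        \<and> tvert \<eta> A \<cdot>\<^bsub>vert D'\<^esub> tvert \<theta> A = Ident (vert D') (omap (pvert G) A))
     \<and> (\<forall>p\<in>Obj (horz D). tcell \<theta> p \<cdot>\<^bsub>horz D'\<^esub> tcell \<eta> p = Ident (horz D') (omap (phorz F) p)
        \<and> tcell \<eta> p \<cdot>\<^bsub>horz D'\<^esub> tcell \<theta> p = Ident (horz D') (omap (phorz G) p))"

definition isomorphic_pdf ::
  "('o, 'v, 'h, 'c) dblcat \<Rightarrow> ('p, 'w, 'k, 'd) dblcat
     \<Rightarrow> ('o, 'v, 'h, 'c, 'p, 'w, 'k, 'd) pdf \<Rightarrow> ('o, 'v, 'h, 'c, 'p, 'w, 'k, 'd) pdf \<Rightarrow> bool" where
  "isomorphic_pdf D D' F G \<longleftrightarrow> (\<exists>\<eta> \<theta>. vertical_transformation D D' F G \<eta>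
     \<and> vertical_transformation D D' G F \<theta> \<and> mutually_inverse D D' F G \<eta> \<theta>)"

definition double_equivalence ::
  "('o, 'v, 'h, 'c) dblcat \<Rightarrow> ('p, 'w, 'k, 'd) dblcat
     \<Rightarrow> ('o, 'v, 'h, 'c, 'p, 'w, 'k, 'd) pdf \<Rightarrow> bool" where
  "double_equivalence D D' F \<longleftrightarrow> pseudo_double_functor D D' F
     \<and> (\<exists>G. pseudo_double_functor D' D G
          \<and> isomorphic_pdf D D (pdf_id D) (pdf_comp D G F)
          \<and> isomorphic_pdf D' D' (pdf_comp D' F G) (pdf_id D'))"


section \<open>The double category of relations\<close>

text \<open>Products, pullbacks and factorisations exist only up to isomorphism, so the operations below
  use a choice of each.\<close>

definition chosen_product :: "('o, 'a) cat \<Rightarrow> 'o \<Rightarrow> 'o \<Rightarrow> 'a \<times> 'a" where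
  "chosen_product C A B = (SOME (p, q). is_product C A B p q)"

definition proj1 :: "('o, 'a) cat \<Rightarrow> 'o \<Rightarrow> 'o \<Rightarrow> 'a" where
  "proj1 C A B = fst (chosen_product C A B)"

definition proj2 :: "('o, 'a) cat \<Rightarrow> 'o \<Rightarrow> 'o \<Rightarrow> 'a" where
  "proj2 C A B = snd (chosen_product C A B)"

definition prod_obj :: "('o, 'a) cat \<Rightarrow> 'o \<Rightarrow> 'o \<Rightarrow> 'o" where
  "prod_obj C A B = Dom C (proj1 C A B)"

definition pair_arr :: "('o, 'a) cat \<Rightarrow> 'a \<Rightarrow> 'a \<Rightarrow> 'a" where
  "pair_arr C f g = (THE h. in_hom C h (Dom C f) (prod_obj C (Cod C f) (Cod C g))
     \<and> proj1 C (Cod C f) (Cod C g) \<cdot>\<^bsub>C\<^esub> h = f \<and> proj2 C (Cod C f) (Cod C g) \<cdot>\<^bsub>C\<^esub> h = g)"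

definition prod_arr :: "('o, 'a) cat \<Rightarrow> 'a \<Rightarrow> 'a \<Rightarrow> 'a" where
  "prod_arr C f g = pair_arr C (f \<cdot>\<^bsub>C\<^esub> proj1 C (Dom C f) (Dom C g))
                             (g \<cdot>\<^bsub>C\<^esub> proj2 C (Dom C f) (Dom C g))"

definition chosen_pullback :: "('o, 'a) cat \<Rightarrow> 'a \<Rightarrow> 'a \<Rightarrow> 'a \<times> 'a" where
  "chosen_pullback C f g = (SOME (p, q). is_pullback C f g p q)"

definition pb1 :: "('o, 'a) cat \<Rightarrow> 'a \<Rightarrow> 'a \<Rightarrow> 'a" where
  "pb1 C f g = fst (chosen_pullback C f g)"

definition pb2 :: "('o, 'a) cat \<Rightarrow> 'a \<Rightarrow> 'a \<Rightarrow> 'a" where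
  "pb2 C f g = snd (chosen_pullback C f g)"

text \<open>The arrow into the pullback of \<open>f\<close> and \<open>g\<close> induced by \<open>u\<close> and \<open>v\<close>.\<close>

definition pb_pair :: "('o, 'a) cat \<Rightarrow> 'a \<Rightarrow> 'a \<Rightarrow> 'a \<Rightarrow> 'a \<Rightarrow> 'a" where
  "pb_pair C f g u v = (THE h. in_hom C h (Dom C u) (Dom C (pb1 C f g))
     \<and> pb1 C f g \<cdot>\<^bsub>C\<^esub> h = u \<and> pb2 C f g \<cdot>\<^bsub>C\<^esub> h = v)"

definition chosen_factorisation :: "('o, 'a) cat \<Rightarrow> 'a set \<Rightarrow> 'a set \<Rightarrow> 'a \<Rightarrow> 'a \<times> 'a" where
  "chosen_factorisation C E M f = (SOME (e, m). is_factorisation C E M f e m)"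

definition epart :: "('o, 'a) cat \<Rightarrow> 'a set \<Rightarrow> 'a set \<Rightarrow> 'a \<Rightarrow> 'a" where
  "epart C E M f = fst (chosen_factorisation C E M f)"

definition mpart :: "('o, 'a) cat \<Rightarrow> 'a set \<Rightarrow> 'a set \<Rightarrow> 'a \<Rightarrow> 'a" where
  "mpart C E M f = snd (chosen_factorisation C E M f)"

text \<open>The diagonal filler \<open>w\<close> of the square \<open>m \<cdot> u = v \<cdot> e\<close>.\<close>

definition filler :: "('o, 'a) cat \<Rightarrow> 'a \<Rightarrow> 'a \<Rightarrow> 'a \<Rightarrow> 'a \<Rightarrow> 'a" where
  "filler C e m u v = (THE w. in_hom C w (Cod C e) (Dom C m) \<and> w \<cdot>\<^bsub>C\<^esub> e = u \<and> m \<cdot>\<^bsub>C\<^esub> w = v)"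

text \<open>The endpoints are recorded because the chosen product objects need not determine them; likewise
  a cell carries its whole boundary.\<close>

record ('o, 'a) mrel =
  rel_src :: 'o
  rel_tgt :: 'o
  rel_leg :: 'a

record ('o, 'a) relcell =
  cell_dom :: "('o, 'a) mrel"
  cell_cod :: "('o, 'a) mrel"
  cell_left :: 'a
  cell_right :: 'a
  cell_map :: 'a

definition rel_l :: "('o, 'a) cat \<Rightarrow> ('o, 'a) mrel \<Rightarrow> 'a" where
  "rel_l C R = proj1 C (rel_src R) (rel_tgt R) \<cdot>\<^bsub>C\<^esub> rel_leg R"

definition rel_r :: "('o, 'a) cat \<Rightarrow> ('o, 'a) mrel \<Rightarrow> 'a" where
  "rel_r C R = proj2 C (rel_src R) (rel_tgt R) \<cdot>\<^bsub>C\<^esub> rel_leg R"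

abbreviation rel_dom :: "('o, 'a) cat \<Rightarrow> ('o, 'a) mrel \<Rightarrow> 'o" where
  "rel_dom C R \<equiv> Dom C (rel_leg R)"

definition is_rel :: "('o, 'a) cat \<Rightarrow> 'a set \<Rightarrow> ('o, 'a) mrel \<Rightarrow> bool" where
  "is_rel C M R \<longleftrightarrow> rel_src R \<in> Obj C \<and> rel_tgt R \<in> Obj C \<and> rel_leg R \<in> M
     \<and> in_hom C (rel_leg R) (rel_dom C R) (prod_obj C (rel_src R) (rel_tgt R))"

definition is_relcell :: "('o, 'a) cat \<Rightarrow> 'a set \<Rightarrow> ('o, 'a) relcell \<Rightarrow> bool" where
  "is_relcell C M \<alpha> \<longleftrightarrow> is_rel C M (cell_dom \<alpha>) \<and> is_rel C M (cell_cod \<alpha>)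
     \<and> in_hom C (cell_left \<alpha>) (rel_src (cell_dom \<alpha>)) (rel_src (cell_cod \<alpha>))
     \<and> in_hom C (cell_right \<alpha>) (rel_tgt (cell_dom \<alpha>)) (rel_tgt (cell_cod \<alpha>))
     \<and> in_hom C (cell_map \<alpha>) (rel_dom C (cell_dom \<alpha>)) (rel_dom C (cell_cod \<alpha>))
     \<and> rel_leg (cell_cod \<alpha>) \<cdot>\<^bsub>C\<^esub> cell_map \<alpha>
       = prod_arr C (cell_left \<alpha>) (cell_right \<alpha>) \<cdot>\<^bsub>C\<^esub> rel_leg (cell_dom \<alpha>)"

definition rel_horz :: "('o, 'a) cat \<Rightarrow> 'a set \<Rightarrow> (('o, 'a) mrel, ('o, 'a) relcell) cat" where
  "rel_horz C M = \<lparr>Obj = {R. is_rel C M R}, Arr = {\<alpha>. is_relcell C M \<alpha>},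
     Dom = cell_dom, Cod = cell_cod,
     Ident = (\<lambda>R. \<lparr>cell_dom = R, cell_cod = R, cell_left = Ident C (rel_src R),
       cell_right = Ident C (rel_tgt R), cell_map = Ident C (rel_dom C R)\<rparr>),
     Cmp = (\<lambda>\<beta> \<alpha>. \<lparr>cell_dom = cell_dom \<alpha>, cell_cod = cell_cod \<beta>,
       cell_left = cell_left \<beta> \<cdot>\<^bsub>C\<^esub> cell_left \<alpha>,
       cell_right = cell_right \<beta> \<cdot>\<^bsub>C\<^esub> cell_right \<alpha>,
       cell_map = cell_map \<beta> \<cdot>\<^bsub>C\<^esub> cell_map \<alpha>\<rparr>)\<rparr>"

definition diag :: "('o, 'a) cat \<Rightarrow> 'o \<Rightarrow> 'a" where
  "diag C A = pair_arr C (Ident C A) (Ident C A)"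

definition rel_unit :: "('o, 'a) cat \<Rightarrow> 'a set \<Rightarrow> 'a set \<Rightarrow> 'o \<Rightarrow> ('o, 'a) mrel" where
  "rel_unit C E M A = \<lparr>rel_src = A, rel_tgt = A, rel_leg = mpart C E M (diag C A)\<rparr>"

definition rel_unit_cell :: "('o, 'a) cat \<Rightarrow> 'a set \<Rightarrow> 'a set \<Rightarrow> 'a \<Rightarrow> ('o, 'a) relcell" where
  "rel_unit_cell C E M f =
    (let I = rel_unit C E M (Dom C f); I' = rel_unit C E M (Cod C f) in
     \<lparr>cell_dom = I, cell_cod = I', cell_left = f, cell_right = f,
      cell_map = filler C (epart C E M (diag C (Dom C f))) (rel_leg I')
        (epart C E M (diag C (Cod C f)) \<cdot>\<^bsub>C\<^esub> f) (prod_arr C f f \<cdot>\<^bsub>C\<^esub> rel_leg I)\<rparr>)"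

definition span1 :: "('o, 'a) cat \<Rightarrow> ('o, 'a) mrel \<Rightarrow> ('o, 'a) mrel \<Rightarrow> 'a" where
  "span1 C R S = pb1 C (rel_r C R) (rel_l C S)"

definition span2 :: "('o, 'a) cat \<Rightarrow> ('o, 'a) mrel \<Rightarrow> ('o, 'a) mrel \<Rightarrow> 'a" where
  "span2 C R S = pb2 C (rel_r C R) (rel_l C S)"

definition span_pair :: "('o, 'a) cat \<Rightarrow> ('o, 'a) mrel \<Rightarrow> ('o, 'a) mrel \<Rightarrow> 'a \<Rightarrow> 'a \<Rightarrow> 'a" where
  "span_pair C R S u v = pb_pair C (rel_r C R) (rel_l C S) u v"

definition span_leg :: "('o, 'a) cat \<Rightarrow> ('o, 'a) mrel \<Rightarrow> ('o, 'a) mrel \<Rightarrow> 'a" where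
  "span_leg C R S = pair_arr C (rel_l C R \<cdot>\<^bsub>C\<^esub> span1 C R S) (rel_r C S \<cdot>\<^bsub>C\<^esub> span2 C R S)"

definition rel_comp ::
  "('o, 'a) cat \<Rightarrow> 'a set \<Rightarrow> 'a set \<Rightarrow> ('o, 'a) mrel \<Rightarrow> ('o, 'a) mrel \<Rightarrow> ('o, 'a) mrel" where
  "rel_comp C E M R S =
    \<lparr>rel_src = rel_src R, rel_tgt = rel_tgt S, rel_leg = mpart C E M (span_leg C R S)\<rparr>"

definition cover ::
  "('o, 'a) cat \<Rightarrow> 'a set \<Rightarrow> 'a set \<Rightarrow> ('o, 'a) mrel \<Rightarrow> ('o, 'a) mrel \<Rightarrow> 'a" where
  "cover C E M R S = epart C E M (span_leg C R S)"

definition rel_comp_cell ::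
  "('o, 'a) cat \<Rightarrow> 'a set \<Rightarrow> 'a set
     \<Rightarrow> ('o, 'a) relcell \<Rightarrow> ('o, 'a) relcell \<Rightarrow> ('o, 'a) relcell" where
  "rel_comp_cell C E M \<alpha> \<beta> =
    (let R = cell_dom \<alpha>; R' = cell_cod \<alpha>; S = cell_dom \<beta>; S' = cell_cod \<beta>;
         RS = rel_comp C E M R S; RS' = rel_comp C E M R' S' in
     \<lparr>cell_dom = RS, cell_cod = RS', cell_left = cell_left \<alpha>, cell_right = cell_right \<beta>,
      cell_map = filler C (cover C E M R S) (rel_leg RS')
        (cover C E M R' S'
           \<cdot>\<^bsub>C\<^esub> span_pair C R' S' (cell_map \<alpha> \<cdot>\<^bsub>C\<^esub> span1 C R S) (cell_map \<beta> \<cdot>\<^bsub>C\<^esub> span2 C R S))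
        (prod_arr C (cell_left \<alpha>) (cell_right \<beta>) \<cdot>\<^bsub>C\<^esub> rel_leg RS)\<rparr>)"

text \<open>A globular cell whose underlying arrow is the filler of the square formed by an arrow \<open>e\<close> of
  \<open>E\<close> onto \<open>R\<close>, an arrow \<open>u\<close> to \<open>S\<close>, and the legs of \<open>R\<close> and \<open>S\<close>.\<close>

definition globular_filler ::
  "('o, 'a) cat \<Rightarrow> ('o, 'a) mrel \<Rightarrow> ('o, 'a) mrel \<Rightarrow> 'a \<Rightarrow> 'a \<Rightarrow> ('o, 'a) relcell" where
  "globular_filler C R S e u = \<lparr>cell_dom = R, cell_cod = S,
     cell_left = Ident C (rel_src R), cell_right = Ident C (rel_tgt R),
     cell_map = filler C e (rel_leg S) u (rel_leg R)\<rparr>"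

text \<open>The coherence isomorphisms are the canonical ones. For the associator, the iterated pullback
  \<open>(R \<times>\<^sub>B S) \<times>\<^sub>C T\<close>, with projections \<open>a\<close> to \<open>R \<times>\<^sub>B S\<close> and \<open>c\<close> to \<open>T\<close>, covers both composites;
  stability of \<open>E\<close> makes the first of these covers an arrow of \<open>E\<close>. For the unitors,
  \<open>R\<close> itself covers its composite with the unit.\<close>

definition rel_assoc ::
  "('o, 'a) cat \<Rightarrow> 'a set \<Rightarrow> 'a set
     \<Rightarrow> ('o, 'a) mrel \<Rightarrow> ('o, 'a) mrel \<Rightarrow> ('o, 'a) mrel \<Rightarrow> ('o, 'a) relcell" where
  "rel_assoc C E M R S T =
    (let RS = rel_comp C E M R S; ST = rel_comp C E M S T;
         a = pb1 C (rel_r C S \<cdot>\<^bsub>C\<^esub> span2 C R S) (rel_l C T);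
         c = pb2 C (rel_r C S \<cdot>\<^bsub>C\<^esub> span2 C R S) (rel_l C T) in
     globular_filler C (rel_comp C E M RS T) (rel_comp C E M R ST)
       (cover C E M RS T \<cdot>\<^bsub>C\<^esub> span_pair C RS T (cover C E M R S \<cdot>\<^bsub>C\<^esub> a) c)
       (cover C E M R ST \<cdot>\<^bsub>C\<^esub> span_pair C R ST (span1 C R S \<cdot>\<^bsub>C\<^esub> a)
          (cover C E M S T \<cdot>\<^bsub>C\<^esub> span_pair C S T (span2 C R S \<cdot>\<^bsub>C\<^esub> a) c)))"

definition rel_lunit ::
  "('o, 'a) cat \<Rightarrow> 'a set \<Rightarrow> 'a set \<Rightarrow> ('o, 'a) mrel \<Rightarrow> ('o, 'a) relcell" where
  "rel_lunit C E M R =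
    (let I = rel_unit C E M (rel_src R); i = epart C E M (diag C (rel_src R)) in
     globular_filler C (rel_comp C E M I R) R
       (cover C E M I R \<cdot>\<^bsub>C\<^esub> span_pair C I R (i \<cdot>\<^bsub>C\<^esub> rel_l C R) (Ident C (rel_dom C R)))
       (Ident C (rel_dom C R)))"

definition rel_runit ::
  "('o, 'a) cat \<Rightarrow> 'a set \<Rightarrow> 'a set \<Rightarrow> ('o, 'a) mrel \<Rightarrow> ('o, 'a) relcell" where
  "rel_runit C E M R =
    (let I = rel_unit C E M (rel_tgt R); i = epart C E M (diag C (rel_tgt R)) in
     globular_filler C (rel_comp C E M R I) R
       (cover C E M R I \<cdot>\<^bsub>C\<^esub> span_pair C R I (Ident C (rel_dom C R)) (i \<cdot>\<^bsub>C\<^esub> rel_r C R))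
       (Ident C (rel_dom C R)))"

definition Rel :: "('o, 'a) cat \<Rightarrow> 'a set \<Rightarrow> 'a set
    \<Rightarrow> ('o, 'a, ('o, 'a) mrel, ('o, 'a) relcell) dblcat" where
  "Rel C E M = \<lparr>vert = C, horz = rel_horz C M,
     src = \<lparr>omap = rel_src, amap = cell_left\<rparr>,
     tgt = \<lparr>omap = rel_tgt, amap = cell_right\<rparr>,
     hunit = \<lparr>omap = rel_unit C E M, amap = rel_unit_cell C E M\<rparr>,
     hcomp = \<lparr>omap = (\<lambda>(R, S). rel_comp C E M R S), amap = (\<lambda>(\<alpha>, \<beta>). rel_comp_cell C E M \<alpha> \<beta>)\<rparr>,
     assoc = rel_assoc C E M, lunit = rel_lunit C E M, runit = rel_runit C E M\<rparr>"

text \<open>\<open>F\<close> exhibits \<open>D\<close> as a double category of relations. HOL cannot quantify existentially over the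
  types of \<open>C\<close>, so the witnesses are arguments.\<close>

definition exhibits_relations ::
  "('o, 'v, 'h, 'c) dblcat \<Rightarrow> ('p, 'w) cat \<Rightarrow> 'w set \<Rightarrow> 'w set
     \<Rightarrow> ('o, 'v, 'h, 'c, 'p, 'w, ('p, 'w) mrel, ('p, 'w) relcell) pdf \<Rightarrow> bool" where
  "exhibits_relations D C E M F \<longleftrightarrow> double_category D \<and> category C \<and> has_finite_limits C
     \<and> stable_ofs C E M \<and> double_equivalence D (Rel C E M) F"

text \<open>The class of vertical arrows of \<open>D\<close> corresponding to a class \<open>K\<close> of arrows of \<open>C\<close>. Both classes of
  a factorisation system are closed under isomorphism of arrows, so this inverse image is also the
  isomorphism closure of the image of \<open>K\<close> under any quasi-inverse.\<close>

definition accompanying_class ::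
  "('o, 'v, 'h, 'c) dblcat \<Rightarrow> ('o, 'v, 'h, 'c, 'p, 'w, 'k, 'd) pdf \<Rightarrow> 'w set \<Rightarrow> 'v set" where
  "accompanying_class D F K = {f \<in> Arr (vert D). amap (pvert F) f \<in> K}"

end

theory Submission
  imports Defs
begin

text \<open>Both sides are invariant under equivalence, so the point is to compare them for relations in
  \<open>C\<close>. Cells with a common boundary are arrows equalised by the leg of their codomain, which lies in
  \<open>M\<close>; so if \<open>M\<close> consists of monomorphisms they coincide. Conversely, an arrow \<open>m : A \<rightarrow> B\<close> in \<open>M\<close> is
  (up to \<open>T \<times> B \<cong> B\<close>, with \<open>T\<close> terminal) the leg of a relation from \<open>T\<close> to \<open>B\<close>, and arrows
  \<open>u, v : X \<rightarrow> A\<close> with \<open>m u = m v\<close> are two cells into it, with the same boundary, from the relation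
  \<open>X \<cong> T \<times> X\<close>.\<close>

section \<open>Monomorphisms and composition of functors\<close>

lemma in_homD: "in_hom C f A B \<Longrightarrow> f \<in> Arr C \<and> Dom C f = A \<and> Cod C f = B"
  by (simp add: in_hom_def)

lemma mono_arrI:
  assumes "m \<in> Arr C"
    and "\<And>X u v. \<lbrakk>in_hom C u X (Dom C m); in_hom C v X (Dom C m); m \<cdot>\<^bsub>C\<^esub> u = m \<cdot>\<^bsub>C\<^esub> v\<rbrakk> \<Longrightarrow> u = v"
  shows "mono_arr C m"
  using assms unfolding mono_arr_def by blast

lemma mono_arrD:
  assumes "mono_arr C m" "in_hom C u X (Dom C m)" "in_hom C v X (Dom C m)"
    and "m \<cdot>\<^bsub>C\<^esub> u = m \<cdot>\<^bsub>C\<^esub> v"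
  shows "u = v"
  using assms unfolding mono_arr_def by blast

lemma is_functor_comp:
  assumes F: "is_functor A B F" and G: "is_functor B C G"
  shows "is_functor A C (ftor_comp G F)"
proof
  show "omap (ftor_comp G F) X \<in> Obj C" if "X \<in> Obj A" for X
    using is_functor.omap_obj[OF G is_functor.omap_obj[OF F that]] by (simp add: ftor_comp_def)
  show "in_hom C (amap (ftor_comp G F) f) (omap (ftor_comp G F) X) (omap (ftor_comp G F) Y)"
    if "in_hom A f X Y" for f X Y
    using is_functor.amap_hom[OF G is_functor.amap_hom[OF F that]] by (simp add: ftor_comp_def)
  show "amap (ftor_comp G F) (Ident A X) = Ident C (omap (ftor_comp G F) X)"
    if "X \<in> Obj A" for X
    using is_functor.amap_ident[OF F that]
      is_functor.amap_ident[OF G is_functor.omap_obj[OF F that]]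
    by (simp add: ftor_comp_def)
  show "amap (ftor_comp G F) (g \<cdot>\<^bsub>A\<^esub> f) = amap (ftor_comp G F) g \<cdot>\<^bsub>C\<^esub> amap (ftor_comp G F) f"
    if "in_hom A f X Y" "in_hom A g Y Z" for f g X Y Z
    using is_functor.amap_comp[OF F that]
      is_functor.amap_comp[OF G is_functor.amap_hom[OF F that(1)] is_functor.amap_hom[OF F that(2)]]
    by (simp add: ftor_comp_def)
qed

context category
begin

lemma hom_obj:
  assumes "in_hom C f A B"
  shows "A \<in> Obj C" "B \<in> Obj C"
  using in_homD[OF assms] dom_obj cod_obj by auto

text \<open>Composing with the retraction \<open>r\<close> removes \<open>s\<close>. Below,
  \<open>s\<close> is usually a component of an isomorphism of double functors and \<open>r\<close>
  is the component of its inverse.\<close>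

lemma section_cancel:
  assumes s: "in_hom C s Y Z" and r: "in_hom C r Z Y" and rs: "r \<cdot>\<^bsub>C\<^esub> s = Ident C Y"
    and f: "in_hom C f X Y" and g: "in_hom C g X Y" and eq: "s \<cdot>\<^bsub>C\<^esub> f = s \<cdot>\<^bsub>C\<^esub> g"
  shows "f = g"
  using comp_assoc[OF f s r] comp_assoc[OF g s r] rs eq ident_left[OF f] ident_left[OF g] by simp

text \<open>Faithfulness cancels what the monomorphism cancels in \<open>B\<close>: from
  \<open>m u = m v\<close> the images of \<open>u\<close> and \<open>v\<close> agree after
  \<open>amap F m\<close>, hence agree.\<close>

lemma functor_mono_reflect:
  assumes F: "is_functor C B F"
    and faithful: "\<And>f g X Y. \<lbrakk>in_hom C f X Y; in_hom C g X Y; amap F f = amap F g\<rbrakk> \<Longrightarrow> f = g"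
    and m: "m \<in> Arr C" and mono: "mono_arr B (amap F m)"
  shows "mono_arr C m"
proof (rule mono_arrI[OF m])
  fix X u v
  assume u: "in_hom C u X (Dom C m)" and v: "in_hom C v X (Dom C m)"
    and eq: "m \<cdot>\<^bsub>C\<^esub> u = m \<cdot>\<^bsub>C\<^esub> v"
  have mh: "in_hom C m (Dom C m) (Cod C m)"
    using m by (simp add: in_hom_def)
  have "Dom B (amap F m) = omap F (Dom C m)"
    using is_functor.amap_hom[OF F mh] by (simp add: in_hom_def)
  moreover have "amap F m \<cdot>\<^bsub>B\<^esub> amap F u = amap F m \<cdot>\<^bsub>B\<^esub> amap F v"
    using is_functor.amap_comp[OF F u mh] is_functor.amap_comp[OF F v mh] eq by simp
  ultimately have "amap F u = amap F v"
    using mono_arrD[OF mono, of "amap F u" "omap F X" "amap F v"]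
      is_functor.amap_hom[OF F u] is_functor.amap_hom[OF F v] by simp
  then show "u = v"
    using faithful[OF u v] by blast
qed

section \<open>Terminal objects and binary products\<close>

lemma terminal_exists:
  assumes "has_finite_limits C"
  obtains T where "T \<in> Obj C" "\<And>X. X \<in> Obj C \<Longrightarrow> \<exists>!h. in_hom C h X T"
proof -
  define J :: "(nat, nat) cat" where
    "J = \<lparr>Obj = {}, Arr = {}, Dom = id, Cod = id, Ident = id, Cmp = (\<lambda>_ _. 0)\<rparr>"
  \<comment> \<open>The diagram is empty, so every record is a functor on it, and a cone is just an
    object of \<open>C\<close>.\<close>
  define F :: "(nat, nat, 'o, 'a) ftor" where "F = undefined"
  have "category J"
    by unfold_locales (auto simp: J_def in_hom_def)
  moreover have "is_functor J C F"
    by unfold_locales (auto simp: J_def in_hom_def)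
  moreover have "finite (Obj J)" "finite (Arr J)"
    by (auto simp: J_def)
  ultimately obtain L t where "is_limit J C F L t"
    using assms unfolding has_finite_limits_def by blast
  then have "L \<in> Obj C" "\<And>X. X \<in> Obj C \<Longrightarrow> \<exists>!h. in_hom C h X L"
    unfolding is_limit_def is_cone_def by (auto simp: J_def)
  then show thesis using that by blast
qed

lemma product_exists:
  assumes "has_finite_limits C" and A: "A \<in> Obj C" and B: "B \<in> Obj C"
  shows "\<exists>p q. is_product C A B p q"
proof -
  define J :: "(nat, nat) cat" where
    \<comment> \<open>The discrete category on two objects. Each arrow is named by its object, so
      composable arrows are equal and their composite may be taken to be the first.\<close>
    "J = \<lparr>Obj = {0, 1}, Arr = {0, 1}, Dom = id, Cod = id, Ident = id, Cmp = (\<lambda>g _. g)\<rparr>"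
  define d where "d = (\<lambda>i::nat. if i = 0 then A else B)"
  define F where "F = \<lparr>omap = d, amap = (\<lambda>i. Ident C (d i))\<rparr>"
  have d: "d i \<in> Obj C" for i
    using A B by (simp add: d_def)
  have "category J"
    by unfold_locales (auto simp: J_def in_hom_def)
  moreover have "is_functor J C F"
    by unfold_locales (auto simp: J_def F_def in_hom_def d ident_hom[OF d, unfolded in_hom_def]
        ident_left[OF ident_hom[OF d]])
  moreover have "finite (Obj J)" "finite (Arr J)"
    by (auto simp: J_def)
  ultimately obtain L t where lim: "is_limit J C F L t"
    using assms unfolding has_finite_limits_def by blast
  \<comment> \<open>The only arrows of \<open>J\<close> are identities, so compatibility with them
    is an identity law of \<open>C\<close>.\<close>
  have cone: "is_cone J C F X s
      \<longleftrightarrow> X \<in> Obj C \<and> in_hom C (s 0) X A \<and> in_hom C (s 1) X B" for X s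
    unfolding is_cone_def using ident_left[of "s 0" X A] ident_left[of "s 1" X B]
    by (auto simp: J_def F_def d_def)
  have t: "in_hom C (t 0) L A" "in_hom C (t 1) L B"
    using lim unfolding is_limit_def cone by auto
  have "\<exists>!h. in_hom C h X L \<and> t 0 \<cdot>\<^bsub>C\<^esub> h = f \<and> t 1 \<cdot>\<^bsub>C\<^esub> h = g"
    if f: "in_hom C f X A" and g: "in_hom C g X B" for X f g
  proof -
    have "X \<in> Obj C"
      using f hom_obj by blast
    then have "is_cone J C F X (\<lambda>i. if i = 0 then f else g)"
      unfolding cone using f g by simp
    then have "\<exists>!h. in_hom C h X L \<and> (\<forall>i\<in>Obj J. t i \<cdot>\<^bsub>C\<^esub> h = (if i = 0 then f else g))"
      using lim unfolding is_limit_def by blast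
    then show ?thesis by (simp add: J_def)
  qed
  then have "is_product C A B (t 0) (t 1)"
    unfolding is_product_def using t by (simp add: in_hom_def)
  then show ?thesis by blast
qed

end

locale finite_limit_category = category +
  assumes finite_limits: "has_finite_limits C"
begin

lemma is_product_proj:
  assumes "A \<in> Obj C" "B \<in> Obj C"
  shows "is_product C A B (proj1 C A B) (proj2 C A B)"
proof -
  have "\<exists>z. case z of (p, q) \<Rightarrow> is_product C A B p q"
    using product_exists[OF finite_limits assms] by auto
  from someI_ex[OF this]
  have "case chosen_product C A B of (p, q) \<Rightarrow> is_product C A B p q"
    by (simp only: chosen_product_def)
  then show ?thesis by (simp add: proj1_def proj2_def case_prod_unfold)
qed

lemma proj1_hom: "\<lbrakk>A \<in> Obj C; B \<in> Obj C\<rbrakk> \<Longrightarrow> in_hom C (proj1 C A B) (prod_obj C A B) A"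
  and proj2_hom: "\<lbrakk>A \<in> Obj C; B \<in> Obj C\<rbrakk> \<Longrightarrow> in_hom C (proj2 C A B) (prod_obj C A B) B"
  using is_product_proj unfolding is_product_def prod_obj_def by blast+

lemma pair_unique:
  assumes "in_hom C f X A" "in_hom C g X B"
  shows "\<exists>!h. in_hom C h X (prod_obj C A B) \<and> proj1 C A B \<cdot>\<^bsub>C\<^esub> h = f \<and> proj2 C A B \<cdot>\<^bsub>C\<^esub> h = g"
proof -
  have "A \<in> Obj C" "B \<in> Obj C"
    using assms hom_obj by blast+
  then show ?thesis
    using is_product_proj assms unfolding is_product_def prod_obj_def by blast
qed

lemma pair_arr:
  assumes f: "in_hom C f X A" and g: "in_hom C g X B"
  shows "in_hom C (pair_arr C f g) X (prod_obj C A B)"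
    and "proj1 C A B \<cdot>\<^bsub>C\<^esub> pair_arr C f g = f"
    and "proj2 C A B \<cdot>\<^bsub>C\<^esub> pair_arr C f g = g"
proof -
  have "pair_arr C f g = (THE h. in_hom C h X (prod_obj C A B)
      \<and> proj1 C A B \<cdot>\<^bsub>C\<^esub> h = f \<and> proj2 C A B \<cdot>\<^bsub>C\<^esub> h = g)"
    using in_homD[OF f] in_homD[OF g] by (simp add: pair_arr_def)
  then show "in_hom C (pair_arr C f g) X (prod_obj C A B)"
    and "proj1 C A B \<cdot>\<^bsub>C\<^esub> pair_arr C f g = f"
    and "proj2 C A B \<cdot>\<^bsub>C\<^esub> pair_arr C f g = g"
    using theI'[OF pair_unique[OF f g]] by metis+
qed

text \<open>Only the second projection is recorded: the products met below have a terminal first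
  factor, where this projection determines the arrow.\<close>

lemma prod_arr:
  assumes f: "in_hom C f A A'" and g: "in_hom C g B B'"
  shows "in_hom C (prod_arr C f g) (prod_obj C A B) (prod_obj C A' B')"
    and "proj2 C A' B' \<cdot>\<^bsub>C\<^esub> prod_arr C f g = g \<cdot>\<^bsub>C\<^esub> proj2 C A B"
proof -
  have AB: "A \<in> Obj C" "B \<in> Obj C"
    using f g hom_obj by blast+
  have "prod_arr C f g = pair_arr C (f \<cdot>\<^bsub>C\<^esub> proj1 C A B) (g \<cdot>\<^bsub>C\<^esub> proj2 C A B)"
    using in_homD[OF f] in_homD[OF g] by (simp add: prod_arr_def)
  then show "in_hom C (prod_arr C f g) (prod_obj C A B) (prod_obj C A' B')"
    and "proj2 C A' B' \<cdot>\<^bsub>C\<^esub> prod_arr C f g = g \<cdot>\<^bsub>C\<^esub> proj2 C A B"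
    using pair_arr[OF comp_hom[OF proj1_hom[OF AB] f] comp_hom[OF proj2_hom[OF AB] g]] by simp_all
qed

text \<open>The inverse of the projection pairs the unique arrow to \<open>T\<close> with the
  identity of \<open>B\<close>.\<close>

lemma proj2_terminal_inverse:
  assumes T: "T \<in> Obj C" and terminal: "\<And>X. X \<in> Obj C \<Longrightarrow> \<exists>!h. in_hom C h X T"
    and B: "B \<in> Obj C"
  obtains s where "in_hom C s B (prod_obj C T B)" "proj2 C T B \<cdot>\<^bsub>C\<^esub> s = Ident C B"
    "s \<cdot>\<^bsub>C\<^esub> proj2 C T B = Ident C (prod_obj C T B)"
proof -
  let ?P = "prod_obj C T B" and ?p = "proj1 C T B" and ?q = "proj2 C T B"
  have p: "in_hom C ?p ?P T" and q: "in_hom C ?q ?P B"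
    using proj1_hom[OF T B] proj2_hom[OF T B] .
  have P: "?P \<in> Obj C"
    using q hom_obj by blast
  obtain t where t: "in_hom C t B T"
    using terminal[OF B] by blast
  define s where "s = pair_arr C t (Ident C B)"
  have s: "in_hom C s B ?P" "?q \<cdot>\<^bsub>C\<^esub> s = Ident C B"
    unfolding s_def using pair_arr[OF t ident_hom[OF B]] by auto
  have sq: "in_hom C (s \<cdot>\<^bsub>C\<^esub> ?q) ?P ?P"
    using comp_hom[OF q s(1)] .
  \<comment> \<open>Both sides are arrows into the terminal object.\<close>
  have "?p \<cdot>\<^bsub>C\<^esub> (s \<cdot>\<^bsub>C\<^esub> ?q) = ?p"
    using terminal[OF P] comp_hom[OF sq p] p by blast
  moreover have "?q \<cdot>\<^bsub>C\<^esub> (s \<cdot>\<^bsub>C\<^esub> ?q) = ?q"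
    using comp_assoc[OF q s(1) q] s(2) ident_left[OF q] by simp
  ultimately have "s \<cdot>\<^bsub>C\<^esub> ?q = Ident C ?P"
    using pair_unique[OF p q] sq ident_hom[OF P] ident_right[OF p] ident_right[OF q] by blast
  then show thesis
    using that s by blast
qed

end

section \<open>Closure properties of the right class\<close>

text \<open>Composing with \<open>a\<close> and \<open>b\<close> turns a lifting problem of some
  \<open>e\<close> against \<open>n\<close> into one against \<open>m\<close>. Its filler returns
  along \<open>a'\<close>, and the left inverse of \<open>b\<close> lets \<open>b\<close> be
  cancelled in the lower triangle.\<close>

lemma (in orthogonal_factorisation_system) right_class_iso_closed:
  assumes "category C" and m: "m \<in> M" and mh: "in_hom C m A B" and nh: "in_hom C n A' B'"
    and a: "in_hom C a A' A" "in_hom C a' A A'" "a' \<cdot>\<^bsub>C\<^esub> a = Ident C A'" "a \<cdot>\<^bsub>C\<^esub> a' = Ident C A"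
    and b: "in_hom C b B' B" "in_hom C b' B B'" "b' \<cdot>\<^bsub>C\<^esub> b = Ident C B'"
    and sq: "b \<cdot>\<^bsub>C\<^esub> n = m \<cdot>\<^bsub>C\<^esub> a"
  shows "n \<in> M"
proof -
  interpret category C by fact
  have "orthogonal C e n" if e: "e \<in> E" for e
  proof -
    have orth: "orthogonal C e m"
      using e m right_class by blast
    then obtain X Y where eh: "in_hom C e X Y"
      by (simp add: orthogonal_def in_hom_def)
    have "\<exists>!w. in_hom C w Y A' \<and> w \<cdot>\<^bsub>C\<^esub> e = u \<and> n \<cdot>\<^bsub>C\<^esub> w = v"
      if u: "in_hom C u X A'" and v: "in_hom C v Y B'" and uv: "n \<cdot>\<^bsub>C\<^esub> u = v \<cdot>\<^bsub>C\<^esub> e" for u v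
    proof -
      have "m \<cdot>\<^bsub>C\<^esub> (a \<cdot>\<^bsub>C\<^esub> u) = (b \<cdot>\<^bsub>C\<^esub> v) \<cdot>\<^bsub>C\<^esub> e"
        using comp_assoc[OF u a(1) mh] comp_assoc[OF u nh b(1)] comp_assoc[OF eh v b(1)] sq uv
        by simp
      then have ex1: "\<exists>!w. in_hom C w Y A \<and> w \<cdot>\<^bsub>C\<^esub> e = a \<cdot>\<^bsub>C\<^esub> u \<and> m \<cdot>\<^bsub>C\<^esub> w = b \<cdot>\<^bsub>C\<^esub> v"
        using orth comp_hom[OF u a(1)] comp_hom[OF v b(1)] in_homD[OF eh] in_homD[OF mh]
        unfolding orthogonal_def by metis
      then obtain w where w: "in_hom C w Y A" "w \<cdot>\<^bsub>C\<^esub> e = a \<cdot>\<^bsub>C\<^esub> u" "m \<cdot>\<^bsub>C\<^esub> w = b \<cdot>\<^bsub>C\<^esub> v"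
        by blast
      show ?thesis
      proof (rule ex1I[of _ "a' \<cdot>\<^bsub>C\<^esub> w"])
        have w': "in_hom C (a' \<cdot>\<^bsub>C\<^esub> w) Y A'"
          using comp_hom[OF w(1) a(2)] .
        have aw': "a \<cdot>\<^bsub>C\<^esub> (a' \<cdot>\<^bsub>C\<^esub> w) = w"
          using comp_assoc[OF w(1) a(2) a(1)] a(4) ident_left[OF w(1)] by simp
        have "(a' \<cdot>\<^bsub>C\<^esub> w) \<cdot>\<^bsub>C\<^esub> e = u"
          using comp_assoc[OF eh w(1) a(2)] w(2) comp_assoc[OF u a(1) a(2)] a(3) ident_left[OF u]
          by simp
        moreover have "b \<cdot>\<^bsub>C\<^esub> (n \<cdot>\<^bsub>C\<^esub> (a' \<cdot>\<^bsub>C\<^esub> w)) = b \<cdot>\<^bsub>C\<^esub> v"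
          using comp_assoc[OF w' nh b(1)] comp_assoc[OF w' a(1) mh] sq aw' w(3) by simp
        then have "n \<cdot>\<^bsub>C\<^esub> (a' \<cdot>\<^bsub>C\<^esub> w) = v"
          using section_cancel[OF b comp_hom[OF w' nh] v] by blast
        ultimately show "in_hom C (a' \<cdot>\<^bsub>C\<^esub> w) Y A' \<and> (a' \<cdot>\<^bsub>C\<^esub> w) \<cdot>\<^bsub>C\<^esub> e = u \<and> n \<cdot>\<^bsub>C\<^esub> (a' \<cdot>\<^bsub>C\<^esub> w) = v"
          using w' by blast
      \<comment> \<open>Uniqueness: for another filler \<open>z\<close>, the arrow
        \<open>a z\<close> solves the problem against \<open>m\<close>, so it equals
        \<open>w\<close>.\<close>
      next
        fix z
        assume z: "in_hom C z Y A' \<and> z \<cdot>\<^bsub>C\<^esub> e = u \<and> n \<cdot>\<^bsub>C\<^esub> z = v"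
        then have zh: "in_hom C z Y A'" by blast
        have "(a \<cdot>\<^bsub>C\<^esub> z) \<cdot>\<^bsub>C\<^esub> e = a \<cdot>\<^bsub>C\<^esub> u"
          using comp_assoc[OF eh zh a(1)] z by simp
        moreover have "m \<cdot>\<^bsub>C\<^esub> (a \<cdot>\<^bsub>C\<^esub> z) = b \<cdot>\<^bsub>C\<^esub> v"
          using comp_assoc[OF zh a(1) mh] comp_assoc[OF zh nh b(1)] sq z by simp
        ultimately have "a \<cdot>\<^bsub>C\<^esub> z = w"
          using ex1 w comp_hom[OF zh a(1)] by blast
        then show "z = a' \<cdot>\<^bsub>C\<^esub> w"
          using comp_assoc[OF zh a(1) a(2)] a(3) ident_left[OF zh] by simp
      qed
    qed
    then show ?thesis
      using orth in_homD[OF eh] in_homD[OF nh] unfolding orthogonal_def by auto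
  qed
  then show ?thesis
    using nh right_class by (auto simp: in_hom_def)
qed

text \<open>In a square against an identity, the lower triangle forces the filler to be
  \<open>v\<close>, and the square itself gives the upper triangle.\<close>

lemma (in orthogonal_factorisation_system) ident_right_class:
  assumes "category C" "X \<in> Obj C"
  shows "Ident C X \<in> M"
proof -
  interpret category C by fact
  have i: "in_hom C (Ident C X) X X"
    using ident_hom[OF assms(2)] .
  have "orthogonal C e (Ident C X)" if "e \<in> E" for e
  proof -
    have e: "e \<in> Arr C"
      using that left_class by blast
    have "\<exists>!w. in_hom C w (Cod C e) X \<and> w \<cdot>\<^bsub>C\<^esub> e = u \<and> Ident C X \<cdot>\<^bsub>C\<^esub> w = v"
      if "in_hom C u (Dom C e) X" "in_hom C v (Cod C e) X" "Ident C X \<cdot>\<^bsub>C\<^esub> u = v \<cdot>\<^bsub>C\<^esub> e" for u v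
      using that ident_left by metis
    then show ?thesis
      using e in_homD[OF i] unfolding orthogonal_def by auto
  qed
  then show ?thesis
    using i right_class by (auto simp: in_hom_def)
qed

section \<open>Faithfulness of double functors isomorphic to the identity\<close>

lemma isomorphic_pdf_sym: "isomorphic_pdf D D' F G \<Longrightarrow> isomorphic_pdf D D' G F"
  unfolding isomorphic_pdf_def mutually_inverse_def by blast

text \<open>By naturality, equal images under \<open>H\<close> make \<open>f\<close> and
  \<open>g\<close> agree after the component of \<eta> at \<open>B\<close>, which has the component
  of \<theta> as retraction.\<close>

lemma vert_faithful_if_isomorphic_id:
  assumes "category (vert D)" and iso: "isomorphic_pdf D D (pdf_id D) H"
    and f: "in_hom (vert D) f A B" and g: "in_hom (vert D) g A B"
    and eq: "amap (pvert H) f = amap (pvert H) g"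
  shows "f = g"
proof -
  interpret category "vert D" by fact
  obtain \<eta> \<theta> where \<eta>: "vertical_transformation D D (pdf_id D) H \<eta>"
    and \<theta>: "vertical_transformation D D H (pdf_id D) \<theta>"
    and inv: "mutually_inverse D D (pdf_id D) H \<eta> \<theta>"
    using iso unfolding isomorphic_pdf_def by blast
  have B: "B \<in> Obj (vert D)"
    using f hom_obj by blast
  show ?thesis
  proof (rule section_cancel)
    show "in_hom (vert D) (tvert \<eta> B) B (omap (pvert H) B)"
      using vertical_transformation.tvert_hom[OF \<eta> B] by (simp add: pdf_id_def ftor_id_def)
    show "in_hom (vert D) (tvert \<theta> B) (omap (pvert H) B) B"
      using vertical_transformation.tvert_hom[OF \<theta> B] by (simp add: pdf_id_def ftor_id_def)
    show "tvert \<theta> B \<cdot>\<^bsub>vert D\<^esub> tvert \<eta> B = Ident (vert D) B"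
      using inv B unfolding mutually_inverse_def by (simp add: pdf_id_def ftor_id_def)
    show "tvert \<eta> B \<cdot>\<^bsub>vert D\<^esub> f = tvert \<eta> B \<cdot>\<^bsub>vert D\<^esub> g"
      using vertical_transformation.tvert_natural[OF \<eta> f]
        vertical_transformation.tvert_natural[OF \<eta> g] eq
      by (simp add: pdf_id_def ftor_id_def)
  qed (fact f g)+
qed

text \<open>The same cancellation, applied to cells and the components of \<eta> and \<theta> at
  \<open>q\<close>.\<close>

lemma horz_faithful_if_isomorphic_id:
  assumes "category (horz D)" and iso: "isomorphic_pdf D D (pdf_id D) H"
    and \<alpha>: "in_hom (horz D) \<alpha> p q" and \<beta>: "in_hom (horz D) \<beta> p q"
    and eq: "amap (phorz H) \<alpha> = amap (phorz H) \<beta>"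
  shows "\<alpha> = \<beta>"
proof -
  interpret category "horz D" by fact
  obtain \<eta> \<theta> where \<eta>: "vertical_transformation D D (pdf_id D) H \<eta>"
    and \<theta>: "vertical_transformation D D H (pdf_id D) \<theta>"
    and inv: "mutually_inverse D D (pdf_id D) H \<eta> \<theta>"
    using iso unfolding isomorphic_pdf_def by blast
  have q: "q \<in> Obj (horz D)"
    using \<alpha> hom_obj by blast
  show ?thesis
  proof (rule section_cancel)
    show "in_hom (horz D) (tcell \<eta> q) q (omap (phorz H) q)"
      using vertical_transformation.tcell_hom[OF \<eta> q] by (simp add: pdf_id_def ftor_id_def)
    show "in_hom (horz D) (tcell \<theta> q) (omap (phorz H) q) q"
      using vertical_transformation.tcell_hom[OF \<theta> q] by (simp add: pdf_id_def ftor_id_def)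
    show "tcell \<theta> q \<cdot>\<^bsub>horz D\<^esub> tcell \<eta> q = Ident (horz D) q"
      using inv q unfolding mutually_inverse_def by (simp add: pdf_id_def ftor_id_def)
    show "tcell \<eta> q \<cdot>\<^bsub>horz D\<^esub> \<alpha> = tcell \<eta> q \<cdot>\<^bsub>horz D\<^esub> \<beta>"
      using vertical_transformation.tcell_natural[OF \<eta> \<alpha>]
        vertical_transformation.tcell_natural[OF \<eta> \<beta>] eq
      by (simp add: pdf_id_def ftor_id_def)
  qed (fact \<alpha> \<beta>)+
qed

section \<open>Cells between relations\<close>

lemma Rel_simps [simp]:
  "vert (Rel C E M) = C"
  "horz (Rel C E M) = rel_horz C M"
  "amap (src (Rel C E M)) = cell_left"
  "amap (tgt (Rel C E M)) = cell_right"
  by (simp_all add: Rel_def)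

text \<open>The last two equations make \<open>cell_map\<close> preserve composites and identities,
  so that equations between cells can be read in \<open>C\<close>.\<close>

lemma rel_horz_simps [simp]:
  "Obj (rel_horz C M) = {R. is_rel C M R}"
  "in_hom (rel_horz C M) \<alpha> R S \<longleftrightarrow> is_relcell C M \<alpha> \<and> cell_dom \<alpha> = R \<and> cell_cod \<alpha> = S"
  "cell_map (\<beta> \<cdot>\<^bsub>rel_horz C M\<^esub> \<alpha>) = cell_map \<beta> \<cdot>\<^bsub>C\<^esub> cell_map \<alpha>"
  "cell_map (Ident (rel_horz C M) R) = Ident C (rel_dom C R)"
  by (auto simp: rel_horz_def in_hom_def)

lemma relcell_map_hom:
  "is_relcell C M \<alpha> \<Longrightarrow>
    in_hom C (cell_map \<alpha>) (rel_dom C (cell_dom \<alpha>)) (rel_dom C (cell_cod \<alpha>))"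
  by (simp add: is_relcell_def)

text \<open>The argument of \<open>horz_faithful_if_isomorphic_id\<close>, carried out on underlying
  arrows, so that only the category laws of \<open>C\<close> enter. The conclusion concerns
  \<open>cell_map\<close> alone; the other fields of a cell are its boundary.\<close>

lemma Rel_cell_map_faithful:
  assumes "category C" and iso: "isomorphic_pdf (Rel C E M) (Rel C E M) (pdf_id (Rel C E M)) H"
    and \<alpha>: "is_relcell C M \<alpha>" "cell_dom \<alpha> = R" "cell_cod \<alpha> = S"
    and \<beta>: "is_relcell C M \<beta>" "cell_dom \<beta> = R" "cell_cod \<beta> = S"
    and eq: "amap (phorz H) \<alpha> = amap (phorz H) \<beta>"
  shows "cell_map \<alpha> = cell_map \<beta>"
proof -
  interpret category C by fact
  let ?D = "Rel C E M"
  obtain \<eta> \<theta> where \<eta>: "vertical_transformation ?D ?D (pdf_id ?D) H \<eta>"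
    and \<theta>: "vertical_transformation ?D ?D H (pdf_id ?D) \<theta>"
    and inv: "mutually_inverse ?D ?D (pdf_id ?D) H \<eta> \<theta>"
    using iso unfolding isomorphic_pdf_def by blast
  have S: "is_rel C M S"
    using \<alpha> by (auto simp: is_relcell_def)
  show ?thesis
  proof (rule section_cancel)
    show "in_hom C (cell_map (tcell \<eta> S)) (rel_dom C S) (rel_dom C (omap (phorz H) S))"
      using vertical_transformation.tcell_hom[OF \<eta>, of S] S
      by (auto simp: pdf_id_def ftor_id_def dest: relcell_map_hom)
    show "in_hom C (cell_map (tcell \<theta> S)) (rel_dom C (omap (phorz H) S)) (rel_dom C S)"
      using vertical_transformation.tcell_hom[OF \<theta>, of S] S
      by (auto simp: pdf_id_def ftor_id_def dest: relcell_map_hom)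
    have "tcell \<theta> S \<cdot>\<^bsub>rel_horz C M\<^esub> tcell \<eta> S = Ident (rel_horz C M) S"
      using inv S unfolding mutually_inverse_def by (simp add: pdf_id_def ftor_id_def)
    from arg_cong[OF this, of cell_map]
    show "cell_map (tcell \<theta> S) \<cdot>\<^bsub>C\<^esub> cell_map (tcell \<eta> S) = Ident C (rel_dom C S)"
      by simp
    have "tcell \<eta> S \<cdot>\<^bsub>rel_horz C M\<^esub> \<alpha> = tcell \<eta> S \<cdot>\<^bsub>rel_horz C M\<^esub> \<beta>"
      using vertical_transformation.tcell_natural[OF \<eta>, of \<alpha> R S]
        vertical_transformation.tcell_natural[OF \<eta>, of \<beta> R S] eq \<alpha> \<beta>
      by (simp add: pdf_id_def ftor_id_def)
    from arg_cong[OF this, of cell_map]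
    show "cell_map (tcell \<eta> S) \<cdot>\<^bsub>C\<^esub> cell_map \<alpha> = cell_map (tcell \<eta> S) \<cdot>\<^bsub>C\<^esub> cell_map \<beta>"
      by simp
    show "in_hom C (cell_map \<alpha>) (rel_dom C R) (rel_dom C S)"
      "in_hom C (cell_map \<beta>) (rel_dom C R) (rel_dom C S)"
      using relcell_map_hom \<alpha> \<beta> by fastforce+
  qed
qed

lemma Rel_locally_preorderedI:
  assumes "\<And>m. m \<in> M \<Longrightarrow> mono_arr C m"
  shows "locally_preordered (Rel C E M)"
  unfolding locally_preordered_def
proof (intro ballI impI, elim conjE)
  fix \<alpha> \<beta>
  assume "\<alpha> \<in> Arr (horz (Rel C E M))" "\<beta> \<in> Arr (horz (Rel C E M))"
    and "Dom (horz (Rel C E M)) \<alpha> = Dom (horz (Rel C E M)) \<beta>"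
      "Cod (horz (Rel C E M)) \<alpha> = Cod (horz (Rel C E M)) \<beta>"
    and sides: "amap (src (Rel C E M)) \<alpha> = amap (src (Rel C E M)) \<beta>"
      "amap (tgt (Rel C E M)) \<alpha> = amap (tgt (Rel C E M)) \<beta>"
  then have cells: "is_relcell C M \<alpha>" "is_relcell C M \<beta>"
    and ends: "cell_dom \<alpha> = cell_dom \<beta>" "cell_cod \<alpha> = cell_cod \<beta>"
    by (auto simp: rel_horz_def)
  have "mono_arr C (rel_leg (cell_cod \<alpha>))"
    using cells(1) assms unfolding is_relcell_def is_rel_def by blast
  \<comment> \<open>Both sides equal the leg of the common domain followed by the product of the
    common vertical sides.\<close>
  moreover have "rel_leg (cell_cod \<alpha>) \<cdot>\<^bsub>C\<^esub> cell_map \<alpha> = rel_leg (cell_cod \<alpha>) \<cdot>\<^bsub>C\<^esub> cell_map \<beta>"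
    using cells sides ends unfolding is_relcell_def by simp
  ultimately have "cell_map \<alpha> = cell_map \<beta>"
    using mono_arrD relcell_map_hom[OF cells(1)] relcell_map_hom[OF cells(2)] ends by metis
  then show "\<alpha> = \<beta>"
    using ends sides by (simp add: relcell.equality)
qed

text \<open>The preorder hypothesis asks only for equal underlying arrows, the form in which it is
  later transferred from an equivalent double category. It is applied to cells into the relation
  from \<open>T\<close> that encodes \<open>m\<close>.\<close>

lemma right_class_mono_if_Rel_locally_preordered:
  assumes "category C" "has_finite_limits C" "orthogonal_factorisation_system C E M"
    and preord: "\<And>\<alpha> \<beta>. \<lbrakk>is_relcell C M \<alpha>; is_relcell C M \<beta>; cell_dom \<alpha> = cell_dom \<beta>;
      cell_cod \<alpha> = cell_cod \<beta>; cell_left \<alpha> = cell_left \<beta>; cell_right \<alpha> = cell_right \<beta>\<rbrakk>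
      \<Longrightarrow> cell_map \<alpha> = cell_map \<beta>"
    and m: "m \<in> M"
  shows "mono_arr C m"
proof -
  interpret category C by fact
  interpret finite_limit_category C by unfold_locales fact
  interpret orthogonal_factorisation_system C E M by fact
  have mA: "m \<in> Arr C"
    using m right_class by blast
  obtain T where T: "T \<in> Obj C" and terminal: "\<And>X. X \<in> Obj C \<Longrightarrow> \<exists>!h. in_hom C h X T"
    using terminal_exists[OF finite_limits] by blast
  \<comment> \<open>The pairing of \<open>n\<close> with the unique arrow from its domain to
    \<open>T\<close>.\<close>
  define leg where "leg n = pair_arr C (THE h. in_hom C h (Dom C n) T) n" for n
  have leg: "in_hom C (leg n) A (prod_obj C T B)" "proj2 C T B \<cdot>\<^bsub>C\<^esub> leg n = n"
    if n: "in_hom C n A B" for n A B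
  proof -
    have "A \<in> Obj C"
      using n hom_obj by blast
    then have "in_hom C (THE h. in_hom C h (Dom C n) T) A T"
      using theI'[OF terminal] in_homD[OF n] by auto
    from pair_arr[OF this n]
    show "in_hom C (leg n) A (prod_obj C T B)" "proj2 C T B \<cdot>\<^bsub>C\<^esub> leg n = n"
      unfolding leg_def by auto
  qed
  define gr where "gr n = \<lparr>rel_src = T, rel_tgt = Cod C n, rel_leg = leg n\<rparr>" for n
  have rel: "is_rel C M (gr n)" if nM: "n \<in> M" and n: "in_hom C n A B" for n A B
  proof -
    have A: "A \<in> Obj C" and B: "B \<in> Obj C"
      using n hom_obj by blast+
    obtain s where s: "in_hom C s B (prod_obj C T B)"
      "s \<cdot>\<^bsub>C\<^esub> proj2 C T B = Ident C (prod_obj C T B)"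
      using proj2_terminal_inverse[OF T terminal B] by blast
    have id: "Ident C A \<cdot>\<^bsub>C\<^esub> Ident C A = Ident C A"
      using ident_left[OF ident_hom[OF A]] .
    \<comment> \<open>This square relates \<open>leg n\<close> to \<open>n\<close> by an identity on
      domains and the invertible projection on codomains, so \<open>leg n\<close> inherits
      membership in \<open>M\<close>.\<close>
    have "proj2 C T B \<cdot>\<^bsub>C\<^esub> leg n = n \<cdot>\<^bsub>C\<^esub> Ident C A"
      using leg(2)[OF n] ident_right[OF n] by simp
    then have "leg n \<in> M"
      using right_class_iso_closed[OF \<open>category C\<close> nM n leg(1)[OF n] ident_hom[OF A] ident_hom[OF A]
          id id proj2_hom[OF T B] s] by blast
    then show ?thesis
      using leg(1)[OF n] in_homD[OF n] T B by (auto simp: is_rel_def gr_def in_hom_def)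
  qed
  show ?thesis
  proof (rule mono_arrI[OF mA])
    fix X u v
    assume u: "in_hom C u X (Dom C m)" and v: "in_hom C v X (Dom C m)"
      and eq: "m \<cdot>\<^bsub>C\<^esub> u = m \<cdot>\<^bsub>C\<^esub> v"
    have X: "X \<in> Obj C"
      using u hom_obj by blast
    \<comment> \<open>The right side is \<open>m w\<close>, with the source encoding the identity of
      \<open>X\<close>. Hence the cells for \<open>u\<close> and \<open>v\<close> share their
      boundary exactly because \<open>m u = m v\<close>, while their underlying arrows are
      \<open>u\<close> and \<open>v\<close>.\<close>
    define cell where "cell w = \<lparr>cell_dom = gr (Ident C X), cell_cod = gr m,
      cell_left = Ident C T, cell_right = m \<cdot>\<^bsub>C\<^esub> w, cell_map = w\<rparr>" for w
    have "is_relcell C M (cell w)" if w: "in_hom C w X (Dom C m)" for w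
    proof -
      have mh: "in_hom C m (Dom C m) (Cod C m)"
        using mA by (simp add: in_hom_def)
      have B: "Cod C m \<in> Obj C"
        using mA cod_obj by blast
      have i: "in_hom C (Ident C X) X X"
        using ident_hom[OF X] .
      have mw: "in_hom C (m \<cdot>\<^bsub>C\<^esub> w) X (Cod C m)"
        using comp_hom[OF w mh] .
      note q = proj2_hom[OF T B] and q' = proj2_hom[OF T X]
      note pa = prod_arr[OF ident_hom[OF T] mw]
      obtain s where s: "in_hom C s (Cod C m) (prod_obj C T (Cod C m))"
        "s \<cdot>\<^bsub>C\<^esub> proj2 C T (Cod C m) = Ident C (prod_obj C T (Cod C m))"
        using proj2_terminal_inverse[OF T terminal B] by blast
      \<comment> \<open>The square condition may be tested after the second projection, which has
        the left inverse \<open>s\<close>; there both composites become \<open>m w\<close>.\<close>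
      have "proj2 C T (Cod C m) \<cdot>\<^bsub>C\<^esub> (leg m \<cdot>\<^bsub>C\<^esub> w) = m \<cdot>\<^bsub>C\<^esub> w"
        using comp_assoc[OF w leg(1)[OF mh] q] leg(2)[OF mh] by simp
      moreover have "proj2 C T (Cod C m) \<cdot>\<^bsub>C\<^esub> (prod_arr C (Ident C T) (m \<cdot>\<^bsub>C\<^esub> w) \<cdot>\<^bsub>C\<^esub> leg (Ident C X))
          = m \<cdot>\<^bsub>C\<^esub> w"
        using comp_assoc[OF leg(1)[OF i] pa(1) q] pa(2) comp_assoc[OF leg(1)[OF i] q' mw]
          leg(2)[OF i] ident_right[OF mw] by simp
      ultimately have "leg m \<cdot>\<^bsub>C\<^esub> w
          = prod_arr C (Ident C T) (m \<cdot>\<^bsub>C\<^esub> w) \<cdot>\<^bsub>C\<^esub> leg (Ident C X)"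
        using section_cancel[OF q s comp_hom[OF w leg(1)[OF mh]] comp_hom[OF leg(1)[OF i] pa(1)]]
        by simp
      then show ?thesis
        using rel[OF m mh] rel[OF ident_right_class[OF \<open>category C\<close> X] i] ident_hom[OF T] mw w
          in_homD[OF leg(1)[OF mh]] in_homD[OF leg(1)[OF i]] in_homD[OF i]
        by (simp add: is_relcell_def cell_def gr_def)
    qed
    from preord[OF this[OF u] this[OF v]]
    have "cell_map (cell u) = cell_map (cell v)"
      using eq by (simp add: cell_def)
    then show "u = v"
      by (simp add: cell_def)
  qed
qed

section \<open>Transport along the equivalence\<close>

text \<open>Pseudo double functors preserve boundaries, so the two images are parallel cells of the
  locally preordered \<open>D'\<close>.\<close>

lemma pdf_eq_if_same_boundary:
  assumes F: "pseudo_double_functor D D' F"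
    and \<alpha>: "\<alpha> \<in> Arr (horz D)" and \<beta>: "\<beta> \<in> Arr (horz D)"
    and dom: "Dom (horz D) \<alpha> = Dom (horz D) \<beta>" and cod: "Cod (horz D) \<alpha> = Cod (horz D) \<beta>"
    and src: "amap (src D) \<alpha> = amap (src D) \<beta>" and tgt: "amap (tgt D) \<alpha> = amap (tgt D) \<beta>"
    and preord: "locally_preordered D'"
  shows "amap (phorz F) \<alpha> = amap (phorz F) \<beta>"
proof -
  have hom: "in_hom (horz D') (amap (phorz F) \<gamma>)
      (omap (phorz F) (Dom (horz D) \<gamma>)) (omap (phorz F) (Cod (horz D) \<gamma>))"
    if "\<gamma> \<in> Arr (horz D)" for \<gamma>
    using is_functor.amap_hom[OF pseudo_double_functor.phorz_functor[OF F]] that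
    by (simp add: in_hom_def)
  have "amap (src D') (amap (phorz F) \<alpha>) = amap (src D') (amap (phorz F) \<beta>)"
    "amap (tgt D') (amap (phorz F) \<alpha>) = amap (tgt D') (amap (phorz F) \<beta>)"
    using pseudo_double_functor.phorz_bdry_arr[OF F \<alpha>]
      pseudo_double_functor.phorz_bdry_arr[OF F \<beta>] src tgt by simp_all
  then show ?thesis
    using preord in_homD[OF hom[OF \<alpha>]] in_homD[OF hom[OF \<beta>]] dom cod
    unfolding locally_preordered_def by simp
qed

text \<open>The naturality square of \<eta> at \<open>m\<close> has invertible sides, so closure of
  \<open>M\<close> under isomorphism applies.\<close>

lemma (in orthogonal_factorisation_system) right_class_isomorphic_id:
  assumes "category C" "vert D = C" and H: "is_functor C C (pvert H)"
    and iso: "isomorphic_pdf D D H (pdf_id D)" and m: "m \<in> M"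
  shows "amap (pvert H) m \<in> M"
proof -
  interpret category C by fact
  obtain \<eta> \<theta> where \<eta>: "vertical_transformation D D H (pdf_id D) \<eta>"
    and \<theta>: "vertical_transformation D D (pdf_id D) H \<theta>"
    and inv: "mutually_inverse D D H (pdf_id D) \<eta> \<theta>"
    using iso unfolding isomorphic_pdf_def by blast
  have mh: "in_hom C m (Dom C m) (Cod C m)"
    using m right_class by (auto simp: in_hom_def)
  then have A: "Dom C m \<in> Obj C" and B: "Cod C m \<in> Obj C"
    using hom_obj by blast+
  have comps: "in_hom C (tvert \<eta> X) (omap (pvert H) X) X"
    "in_hom C (tvert \<theta> X) X (omap (pvert H) X)"
    "tvert \<theta> X \<cdot>\<^bsub>C\<^esub> tvert \<eta> X = Ident C (omap (pvert H) X)"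
    "tvert \<eta> X \<cdot>\<^bsub>C\<^esub> tvert \<theta> X = Ident C X" if "X \<in> Obj C" for X
    using vertical_transformation.tvert_hom[OF \<eta>, of X]
      vertical_transformation.tvert_hom[OF \<theta>, of X] inv that \<open>vert D = C\<close>
    unfolding mutually_inverse_def by (auto simp: pdf_id_def ftor_id_def)
  have "tvert \<eta> (Cod C m) \<cdot>\<^bsub>C\<^esub> amap (pvert H) m = m \<cdot>\<^bsub>C\<^esub> tvert \<eta> (Dom C m)"
    using vertical_transformation.tvert_natural[OF \<eta>] mh \<open>vert D = C\<close>
    by (simp add: pdf_id_def ftor_id_def)
  then show ?thesis
    using right_class_iso_closed[OF \<open>category C\<close> m mh is_functor.amap_hom[OF H mh]
        comps[OF A] comps(1-3)[OF B]] by blast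
qed

theorem mainTheorem4:
  fixes D :: "('o, 'v, 'h, 'c) dblcat"
    and C :: "('p, 'w) cat" and E M :: "'w set"
    and F :: "('o, 'v, 'h, 'c, 'p, 'w, ('p, 'w) mrel, ('p, 'w) relcell) pdf"
  assumes "exhibits_relations D C E M F"
  shows "locally_preordered D \<longleftrightarrow>
    right_proper (vert D) (accompanying_class D F E) (accompanying_class D F M)"
proof -
  have D: "double_category D" and C: "category C" and lim: "has_finite_limits C"
    and "stable_ofs C E M" and eqv: "double_equivalence D (Rel C E M) F"
    using assms unfolding exhibits_relations_def by auto
  then have ofs: "orthogonal_factorisation_system C E M"
    by (simp add: stable_ofs_def)
  obtain G where F: "pseudo_double_functor D (Rel C E M) F"
    and G: "pseudo_double_functor (Rel C E M) D G"
    and GF: "isomorphic_pdf D D (pdf_id D) (pdf_comp D G F)"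
    and FG: "isomorphic_pdf (Rel C E M) (Rel C E M) (pdf_comp (Rel C E M) F G) (pdf_id (Rel C E M))"
    using eqv unfolding double_equivalence_def by blast
  note FG' = isomorphic_pdf_sym[OF FG]
  have vF: "is_functor (vert D) C (pvert F)" and vG: "is_functor C (vert D) (pvert G)"
    using pseudo_double_functor.pvert_functor[OF F] pseudo_double_functor.pvert_functor[OF G]
    by simp_all
  interpret V: category "vert D"
    using D by (rule double_category.vert_category)
  interpret C: category C by fact
  show ?thesis
  proof
    assume pre: "locally_preordered D"
    have "mono_arr C m" if "m \<in> M" for m
    proof (rule right_class_mono_if_Rel_locally_preordered[OF C lim ofs _ that])
      fix \<alpha> \<beta>
      assume cells: "is_relcell C M \<alpha>" "is_relcell C M \<beta>" "cell_dom \<alpha> = cell_dom \<beta>"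
        "cell_cod \<alpha> = cell_cod \<beta>" "cell_left \<alpha> = cell_left \<beta>" "cell_right \<alpha> = cell_right \<beta>"
      \<comment> \<open>\<open>G\<close> carries the two cells into \<open>D\<close>, where they
        become equal. Their images under the composite \<open>F G\<close>, isomorphic to the
        identity, then agree too, so the underlying arrows coincide.\<close>
      have "amap (phorz G) \<alpha> = amap (phorz G) \<beta>"
        by (rule pdf_eq_if_same_boundary[OF G _ _ _ _ _ _ pre])
          (use cells in \<open>auto simp: rel_horz_def\<close>)
      then show "cell_map \<alpha> = cell_map \<beta>"
        using Rel_cell_map_faithful[OF C FG' cells(1) refl refl cells(2)] cells
        by (simp add: pdf_comp_def ftor_comp_def)
    qed
    \<comment> \<open>Equal images under \<open>F\<close> give equal images under
      \<open>G F\<close>, which is isomorphic to the identity. So \<open>F\<close> is faithful on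
      vertical arrows and reflects monomorphisms from \<open>C\<close> to \<open>D\<close>.\<close>
    moreover have "f = g" if "in_hom (vert D) f X Y" "in_hom (vert D) g X Y"
      "amap (pvert F) f = amap (pvert F) g" for f g X Y
      using vert_faithful_if_isomorphic_id[OF V.category_axioms GF that(1,2)] that(3)
      by (simp add: pdf_comp_def ftor_comp_def)
    ultimately show "right_proper (vert D) (accompanying_class D F E) (accompanying_class D F M)"
      using V.functor_mono_reflect[OF vF] unfolding right_proper_def accompanying_class_def by blast
  next
    assume proper: "right_proper (vert D) (accompanying_class D F E) (accompanying_class D F M)"
    have "mono_arr C m" if m: "m \<in> M" for m
    \<comment> \<open>It suffices that the image of \<open>m\<close> under \<open>G\<close> is a
      monomorphism. This image is in the accompanying class because applying \<open>F\<close> to it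
      gives an arrow isomorphic to \<open>m\<close>.\<close>
    proof (rule C.functor_mono_reflect[OF vG])
      show "f = g" if "in_hom C f X Y" "in_hom C g X Y" "amap (pvert G) f = amap (pvert G) g"
        for f g X Y
        using vert_faithful_if_isomorphic_id[OF _ FG'] C that
        by (simp add: pdf_comp_def ftor_comp_def)
      show mA: "m \<in> Arr C"
        using m orthogonal_factorisation_system.right_class[OF ofs] by blast
      have "is_functor C C (pvert (pdf_comp (Rel C E M) F G))"
        using is_functor_comp[OF vG vF] by (simp add: pdf_comp_def)
      then have "amap (pvert F) (amap (pvert G) m) \<in> M"
        using orthogonal_factorisation_system.right_class_isomorphic_id[OF ofs C _ _ FG m]
        by (simp add: pdf_comp_def ftor_comp_def)
      moreover have "amap (pvert G) m \<in> Arr (vert D)"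
        using is_functor.amap_hom[OF vG] mA unfolding in_hom_def by blast
      ultimately show "mono_arr (vert D) (amap (pvert G) m)"
        using proper unfolding right_proper_def accompanying_class_def by blast
    qed
    then have pre: "locally_preordered (Rel C E M)"
      by (rule Rel_locally_preorderedI)
    show "locally_preordered D"
      unfolding locally_preordered_def
    proof (intro ballI impI, elim conjE)
      fix \<alpha> \<beta>
      assume arrs: "\<alpha> \<in> Arr (horz D)" "\<beta> \<in> Arr (horz D)"
        and bdry: "Dom (horz D) \<alpha> = Dom (horz D) \<beta>" "Cod (horz D) \<alpha> = Cod (horz D) \<beta>"
          "amap (src D) \<alpha> = amap (src D) \<beta>" "amap (tgt D) \<alpha> = amap (tgt D) \<beta>"
      \<comment> \<open>The images are parallel cells of relations, hence equal; \<open>F\<close> is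
        faithful on cells because \<open>G F\<close> is isomorphic to the identity.\<close>
      have "amap (phorz F) \<alpha> = amap (phorz F) \<beta>"
        by (rule pdf_eq_if_same_boundary[OF F arrs bdry pre])
      then show "\<alpha> = \<beta>"
        using horz_faithful_if_isomorphic_id[OF double_category.horz_category[OF D] GF] arrs bdry
        by (simp add: pdf_comp_def ftor_comp_def in_hom_def)
    qed
  qed
qed

end
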